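(* Let $\Omega$ be a bounded domain in $\mathbb{R}^2$ with smooth boundary $\partial\Omega$. There exists a positive constant $C$ depending only on $\Omega$ such that, for every $p>2$, every $f\in H^1(\Omega)$ and every $g\in L^p(\Omega)$, $$ \| f g\|_{L^2(\Omega)}\leq C \left(\frac{p}{p-2} \right)^{\frac12} \| f\|_{H^1(\Omega)}\, \| g\|_{L^2(\Omega)} \, \ln^{\frac12} \left( e\, |\Omega|^{\frac{p-2}{2p}}\, \frac{\| g\|_{L^p(\Omega)}}{\| g\|_{L^2(\Omega)}} \right). $$
   Context: $|\Omega|$ denotes the Lebesgue measure of $\Omega$, $e$ is Euler's number and $\ln^{1/2}(x)=(\ln x)^{1/2}$. When $g=0$ the right-hand side is understood to be $0$. *)

theory Defs
  imports "HOL-Analysis.Analysis"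
begin

primrec Ck_fun :: "nat \<Rightarrow> ('a::euclidean_space \<Rightarrow> real) \<Rightarrow> bool" where
  "Ck_fun 0 f \<longleftrightarrow> continuous_on UNIV f"
| "Ck_fun (Suc k) f \<longleftrightarrow> (\<forall>x. f differentiable (at x)) \<and>
     (\<forall>b\<in>Basis. Ck_fun k (\<lambda>x. frechet_derivative f (at x) b))"

definition smooth_fun :: "('a::euclidean_space \<Rightarrow> real) \<Rightarrow> bool" where
  "smooth_fun f \<longleftrightarrow> (\<forall>k. Ck_fun k f)"

text \<open>Near each boundary point, and in the coordinates of some orthonormal frame, the
  set is the strict epigraph of a smooth function of one variable; in particular it lies
  locally on one side of its boundary.\<close>

definition smooth_boundary :: "(real^2) set \<Rightarrow> bool" where
  "smooth_boundary \<Omega> \<longleftrightarrow>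
     (\<forall>z \<in> frontier \<Omega>. \<exists>r>0. \<exists>u v. \<exists>\<gamma> :: real \<Rightarrow> real.
        norm u = 1 \<and> norm v = 1 \<and> u \<bullet> v = 0 \<and> smooth_fun \<gamma> \<and>
        \<Omega> \<inter> ball z r = {y \<in> ball z r. y \<bullet> v > \<gamma> (y \<bullet> u)})"

definition smooth_bounded_domain :: "(real^2) set \<Rightarrow> bool" where
  "smooth_bounded_domain \<Omega> \<longleftrightarrow>
     open \<Omega> \<and> connected \<Omega> \<and> \<Omega> \<noteq> {} \<and> bounded \<Omega> \<and> smooth_boundary \<Omega>"

text \<open>Elements of Lebesgue and Sobolev spaces are represented by functions on the whole
  space, of which only the values on \<open>\<Omega>\<close> matter; functions equal almost everywhere on
  \<open>\<Omega>\<close> are not identified. The exponent is finite. For a function outside the space,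
  \<open>Lp_norm\<close> carries no information, since the Bochner integral is then 0 by convention.\<close>

definition Lp_space :: "real \<Rightarrow> 'a::euclidean_space set \<Rightarrow> ('a \<Rightarrow> real) set" where
  "Lp_space p \<Omega> = {f. f \<in> borel_measurable (lebesgue_on \<Omega>) \<and>
                       integrable (lebesgue_on \<Omega>) (\<lambda>x. \<bar>f x\<bar> powr p)}"

definition Lp_norm :: "real \<Rightarrow> 'a::euclidean_space set \<Rightarrow> ('a \<Rightarrow> real) \<Rightarrow> real" where
  "Lp_norm p \<Omega> f = (LINT x|lebesgue_on \<Omega>. \<bar>f x\<bar> powr p) powr (1 / p)"

definition test_fun :: "'a::euclidean_space set \<Rightarrow> ('a \<Rightarrow> real) \<Rightarrow> bool" where
  "test_fun \<Omega> \<phi> \<longleftrightarrow> smooth_fun \<phi> \<and>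
     compact (closure {x. \<phi> x \<noteq> 0}) \<and> closure {x. \<phi> x \<noteq> 0} \<subseteq> \<Omega>"

definition locally_integrable :: "'a::euclidean_space set \<Rightarrow> ('a \<Rightarrow> real) \<Rightarrow> bool" where
  "locally_integrable \<Omega> f \<longleftrightarrow> (\<forall>K. compact K \<and> K \<subseteq> \<Omega> \<longrightarrow> f absolutely_integrable_on K)"

definition weak_partial ::
  "'a::euclidean_space set \<Rightarrow> 'a \<Rightarrow> ('a \<Rightarrow> real) \<Rightarrow> ('a \<Rightarrow> real) \<Rightarrow> bool" where
  "weak_partial \<Omega> b f h \<longleftrightarrow> locally_integrable \<Omega> f \<and> locally_integrable \<Omega> h \<and>
     (\<forall>\<phi>. test_fun \<Omega> \<phi> \<longrightarrow>
        (LINT x|lebesgue_on \<Omega>. f x * frechet_derivative \<phi> (at x) b) =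
        - (LINT x|lebesgue_on \<Omega>. h x * \<phi> x))"

definition H1_space :: "'a::euclidean_space set \<Rightarrow> ('a \<Rightarrow> real) set" where
  "H1_space \<Omega> = {f \<in> Lp_space 2 \<Omega>. \<forall>b\<in>Basis. \<exists>h \<in> Lp_space 2 \<Omega>. weak_partial \<Omega> b f h}"

text \<open>For open \<open>\<Omega>\<close> a weak partial derivative is unique up to null sets, so the choice below
  does not affect the value of \<open>H1_norm\<close>.\<close>

definition weak_deriv :: "'a::euclidean_space set \<Rightarrow> 'a \<Rightarrow> ('a \<Rightarrow> real) \<Rightarrow> ('a \<Rightarrow> real)" where
  "weak_deriv \<Omega> b f = (SOME h. h \<in> Lp_space 2 \<Omega> \<and> weak_partial \<Omega> b f h)"

definition H1_norm :: "'a::euclidean_space set \<Rightarrow> ('a \<Rightarrow> real) \<Rightarrow> real" where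
  "H1_norm \<Omega> f =
     sqrt ((Lp_norm 2 \<Omega> f)\<^sup>2 + (\<Sum>b\<in>Basis. (Lp_norm 2 \<Omega> (weak_deriv \<Omega> b f))\<^sup>2))"

end

theory Submission
  imports Defs
begin

text \<open>
  The estimate follows from the Sobolev embedding of $H^1$ into $L^q$ for all finite $q$, provided that
  the growth of the embedding constant is known: for every natural number $m \geq 1$,
  \[ \|f\|_{L^{2m}} \leq C \sqrt{m}\, \|f\|_{H^1} . \]
  This is \<open>H1_power_integral_bound\<close>. Given it, Hoelder's inequality for $f^2 g^2$, split into powers of
  $|f|^{2m}$, $g^2$ and $|g|^p$ with weights $1/m$, $1 - \theta$ and $2\theta/p$, yields
  \[ \|fg\|_2^2 \leq C m \|f\|_{H^1}^2 \|g\|_2^2 (\|g\|_p / \|g\|_2)^{2\theta}, \qquad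
     \theta = \frac{p}{m(p-2)} \]
  (\<open>product_L2_bound\<close>). With $L$ the logarithm in the theorem and $m$ close to $2 p L / (p-2)$ one has
  $2 \theta L \leq 1$, so the last power is bounded by a constant, while $m$ is, up to a constant, the factor
  $p L / (p-2)$ that the theorem allows.

  The embedding rests on the pointwise bound (\<open>pointwise_bound\<close>)
  \[ |f(x)| \leq C \Big( \int_\Omega |f| + \int_\Omega \frac{|\nabla f(y)|}{|x-y|}\, dy \Big)
     \quad\mbox{for almost every } x \in \Omega . \]
  Every point of the closure of $\Omega$ has a neighbourhood such that a fixed truncated cone, attached to
  any point of $\Omega$ in it, stays inside $\Omega$. Average $f$ near $x$ against a bump function supported in
  the cone and shrunk towards $x$ by a factor $t$. The derivative of this average in $t$ pairs $f$ with the divergence of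
  a test field supported in the cone, so by the definition of the weak derivative it is an average of
  $\nabla f$ (\<open>averaged_gradient_identity\<close>); integrating it over the scales gives the kernel
  $1/|x-y|$ (\<open>average_bound\<close>). The shrinking averages are compared with $f$ through integrals over boxes
  (\<open>box_integral_bound\<close>), which determine $f$ almost everywhere.

  The factor $\sqrt m$ comes from the Riesz potential (\<open>Riesz_potential_power_integral\<close>): writing
  $G/|x-y|$ as a product of powers of $G^2/|x-y|$, $G^2$ and $|x-y|^{-(2-1/m)}$, the only constant
  that grows is $\int |x-y|^{-(2-1/m)}\,dy$, which is of order $m$ in the plane and enters with weight $1/2$.
\<close>

section \<open>Smooth bump functions\<close>

lemma Ck_fun_SucD: "Ck_fun (Suc k) f \<Longrightarrow> Ck_fun k f"
proof (induction k arbitrary: f)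
  case 0
  then show ?case
    by (auto simp: continuous_on_eq_continuous_at intro: differentiable_imp_continuous_within)
next
  case (Suc k)
  then show ?case by (metis Ck_fun.simps(2))
qed

lemma Ck_fun_const: "Ck_fun k (\<lambda>x. c)"
  by (induction k arbitrary: c) (simp_all add: frechet_derivative_const)

lemma Ck_fun_inner: "Ck_fun k (\<lambda>x. (x - a) \<bullet> b)"
proof (cases k)
  case (Suc m)
  have d: "((\<lambda>x. (x - a) \<bullet> b) has_derivative (\<lambda>h. h \<bullet> b)) (at x)" for x
    by (auto intro!: derivative_eq_intros)
  show ?thesis
    unfolding Suc using d frechet_derivative_at[OF d, symmetric] 
    by (auto simp: Ck_fun_const differentiable_def)
qed (auto intro!: continuous_intros)

lemma Ck_fun_add:
  "Ck_fun k f \<Longrightarrow> Ck_fun k g \<Longrightarrow> Ck_fun k (\<lambda>x. f x + g x)"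
proof (induction k arbitrary: f g)
  case 0
  then show ?case by (auto intro!: continuous_intros)
next
  case (Suc k)
  have "frechet_derivative (\<lambda>x. f x + g x) (at x)
      = (\<lambda>b. frechet_derivative f (at x) b + frechet_derivative g (at x) b)" for x
    using Suc.prems
    by (intro frechet_derivative_at[symmetric] has_derivative_add)
       (auto simp: frechet_derivative_works)
  then show ?case using Suc by auto
qed

lemma Ck_fun_mult:
  "Ck_fun k f \<Longrightarrow> Ck_fun k g \<Longrightarrow> Ck_fun k (\<lambda>x. f x * g x)"
proof (induction k arbitrary: f g)
  case 0
  then show ?case by (auto intro!: continuous_intros)
next
  case (Suc k)
  have "frechet_derivative (\<lambda>x. f x * g x) (at x)
      = (\<lambda>b. f x * frechet_derivative g (at x) b + frechet_derivative f (at x) b * g x)" for x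
    using Suc.prems
    by (intro frechet_derivative_at[symmetric] has_derivative_mult)
       (auto simp: frechet_derivative_works)
  moreover have "Ck_fun k f" "Ck_fun k g"
    using Suc.prems Ck_fun_SucD by blast+
  ultimately show ?case using Suc by (auto intro!: Ck_fun_add)
qed

lemma Ck_fun_sum:
  "finite A \<Longrightarrow> (\<And>i. i \<in> A \<Longrightarrow> Ck_fun k (f i)) \<Longrightarrow> Ck_fun k (\<lambda>x. \<Sum>i\<in>A. f i x)"
  by (induction A rule: finite_induct) (auto intro: Ck_fun_const Ck_fun_add)

text \<open>
  By the chain rule the derivative of the composition is a product of $g' \circ q$ and a derivative of $q$,
  to which the induction hypothesis and the product rule apply; this is why products come first.
\<close>

lemma Ck_fun_compose:
  fixes g :: "real \<Rightarrow> real"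
  shows "Ck_fun k g \<Longrightarrow> Ck_fun k q \<Longrightarrow> Ck_fun k (\<lambda>x. g (q x))"
proof (induction k arbitrary: g q)
  case 0
  then show ?case by (auto intro: continuous_on_compose2)
next
  case (Suc k)
  have "frechet_derivative (\<lambda>x. g (q x)) (at x)
      = (\<lambda>b. frechet_derivative g (at (q x)) 1 * frechet_derivative q (at x) b)" for x
  proof -
    have "((\<lambda>x. g (q x)) has_derivative
        (\<lambda>b. frechet_derivative g (at (q x)) (frechet_derivative q (at x) b))) (at x)"
      using Suc.prems by (intro has_derivative_compose[of q _ x UNIV g, simplified])
         (auto simp: frechet_derivative_works)
    moreover have "linear (frechet_derivative g (at (q x)))"
      using Suc.prems by (auto intro: linear_frechet_derivative)
    then have "frechet_derivative g (at (q x)) r = frechet_derivative g (at (q x)) 1 * r" for r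
      using linear_cmul[of "frechet_derivative g (at (q x))" r 1] by (simp add: mult.commute)
    ultimately show ?thesis using frechet_derivative_at by metis
  qed
  moreover have "(\<lambda>x. g (q x)) differentiable (at x)" for x
    using Suc.prems differentiable_chain_at[of q x g] by (auto simp: o_def)
  moreover have "Ck_fun k q"
    using Suc.prems Ck_fun_SucD by blast
  ultimately show ?case using Suc by (auto intro!: Ck_fun_mult)
qed

lemma Ck_fun_affine:
  "Ck_fun k f \<Longrightarrow> Ck_fun k (\<lambda>x. f (c *\<^sub>R (x - a)))"
proof (induction k arbitrary: f)
  case 0
  then show ?case by (auto intro!: continuous_on_compose2[of UNIV f] continuous_intros)
next
  case (Suc k)
  have d: "((\<lambda>x. f (c *\<^sub>R (x - a))) has_derivative
        (\<lambda>b. frechet_derivative f (at (c *\<^sub>R (x - a))) (c *\<^sub>R b))) (at x)" for x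
    using Suc.prems
    by (intro has_derivative_compose[of "\<lambda>x. c *\<^sub>R (x - a)" _ x UNIV f, simplified])
       (auto simp: frechet_derivative_works[symmetric] intro!: derivative_eq_intros)
  have "frechet_derivative (\<lambda>x. f (c *\<^sub>R (x - a))) (at x)
      = (\<lambda>b. c * frechet_derivative f (at (c *\<^sub>R (x - a))) b)" for x
  proof -
    have "linear (frechet_derivative f (at (c *\<^sub>R (x - a))))"
      using Suc.prems by (auto intro: linear_frechet_derivative)
    then show ?thesis using frechet_derivative_at[OF d[of x], symmetric]
      by (simp add: linear_cmul)
  qed
  moreover have "(\<lambda>x. f (c *\<^sub>R (x - a))) differentiable (at x)" for x
    using d differentiable_def by blast
  moreover have "Ck_fun k (\<lambda>x. frechet_derivative f (at (c *\<^sub>R (x - a))) b)" if "b \<in> Basis" for b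
    using Suc.IH[of "\<lambda>x. frechet_derivative f (at x) b"] Suc.prems that by simp
  ultimately show ?case by (auto intro!: Ck_fun_mult Ck_fun_const)
qed

text \<open>
  The classical flat function $e^{-1/x}$, multiplied by polynomials in $1/x$. This family is closed under
  differentiation, which makes smoothness an immediate induction.
\<close>

definition poly_exp_cutoff :: "real poly \<Rightarrow> real \<Rightarrow> real" where
  "poly_exp_cutoff P x = (if x \<le> 0 then 0 else poly P (1 / x) * exp (- (1 / x)))"

lemma poly_div_exp_tendsto_0: "((\<lambda>s::real. poly P s / exp s) \<longlongrightarrow> 0) at_top"
proof -
  have "((\<lambda>s. \<Sum>i\<le>degree P. coeff P i * (s ^ i / exp s)) \<longlongrightarrow> (\<Sum>i\<le>degree P. coeff P i * 0)) at_top"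
    by (intro tendsto_intros tendsto_power_div_exp_0)
  then show ?thesis by (simp add: poly_altdef sum_divide_distrib)
qed

text \<open>
  Only $x = 0$ needs an argument: there the difference quotient from the right is again a polynomial in $1/x$
  times $e^{-1/x}$, and tends to 0.
\<close>

lemma poly_exp_cutoff_has_derivative:
  "(poly_exp_cutoff P has_real_derivative
     poly_exp_cutoff ([:0, 0, 1:] * (P - pderiv P)) x) (at x)"
proof -
  consider "x < 0" | "x = 0" | "x > 0" by linarith
  then show ?thesis
  proof cases
    case 1
    have "((\<lambda>x. 0) has_real_derivative 0) (at x)" by simp
    then have "(poly_exp_cutoff P has_real_derivative 0) (at x)"
      by (rule has_field_derivative_transform_within_open[where S="{..<0}"])
         (use 1 in \<open>auto simp: poly_exp_cutoff_def\<close>)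
    then show ?thesis using 1 by (simp add: poly_exp_cutoff_def)
  next
    case 3
    have "((\<lambda>x. poly P (1 / x) * exp (- (1 / x))) has_real_derivative
            poly_exp_cutoff ([:0, 0, 1:] * (P - pderiv P)) x) (at x)"
      using 3 by (auto intro!: derivative_eq_intros DERIV_chain'[OF _ poly_DERIV]
          simp: poly_exp_cutoff_def field_simps power2_eq_square)
    then show ?thesis
      by (rule has_field_derivative_transform_within_open[where S="{0<..}"])
         (use 3 in \<open>auto simp: poly_exp_cutoff_def\<close>)
  next
    case 2
    have "((\<lambda>h. poly (pCons 0 P) (inverse h) / exp (inverse h)) \<longlongrightarrow> 0) (at_right (0::real))"
      by (rule filterlim_compose[OF poly_div_exp_tendsto_0 filterlim_inverse_at_top_right])
    then have "((\<lambda>h. poly_exp_cutoff P h / h) \<longlongrightarrow> 0) (at_right 0)"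
      by (rule Lim_transform_eventually)
         (auto simp: eventually_at_right_less poly_exp_cutoff_def exp_minus field_simps
            intro!: eventually_mono[OF eventually_at_right_less[of 0]])
    moreover have "((\<lambda>h. poly_exp_cutoff P h / h) \<longlongrightarrow> 0) (at_left 0)"
      by (rule Lim_transform_eventually[OF tendsto_const])
         (auto simp: poly_exp_cutoff_def intro!: eventually_mono[OF eventually_at_left_real[of "-1" 0]])
    ultimately have "((\<lambda>h. poly_exp_cutoff P h / h) \<longlongrightarrow> 0) (at 0)"
      by (simp add: filterlim_split_at)
    then show ?thesis using 2 by (simp add: DERIV_def poly_exp_cutoff_def)
  qed
qed

lemma Ck_fun_poly_exp_cutoff: "Ck_fun k (poly_exp_cutoff P)"
proof (induction k arbitrary: P)
  case 0
  show ?case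
    using DERIV_isCont[OF poly_exp_cutoff_has_derivative]
    by (simp add: continuous_on_eq_continuous_at)
next
  case (Suc k)
  have "frechet_derivative (poly_exp_cutoff P) (at x) 1
      = poly_exp_cutoff ([:0, 0, 1:] * (P - pderiv P)) x" for x
    using frechet_derivative_at[OF poly_exp_cutoff_has_derivative[of P x, unfolded has_field_derivative_def], symmetric]
    by simp
  moreover have "poly_exp_cutoff P differentiable (at x)" for x
    using poly_exp_cutoff_has_derivative real_differentiable_def by blast
  ultimately show ?case using Suc by simp
qed

lemma Ck_fun_one_minus_norm_square: "Ck_fun k (\<lambda>z::'a::euclidean_space. 1 - z \<bullet> z)"
proof -
  have "Ck_fun k (\<lambda>z::'a. 1 + (\<Sum>b\<in>Basis. (-1) * (((z - 0) \<bullet> b) * ((z - 0) \<bullet> b))))"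
    by (intro Ck_fun_add Ck_fun_sum Ck_fun_mult Ck_fun_const Ck_fun_inner) auto
  moreover have "1 + (\<Sum>b\<in>Basis. (-1) * (((z - 0) \<bullet> b) * ((z - 0) \<bullet> b))) = 1 - z \<bullet> z" for z :: 'a
    by (subst euclidean_inner) (simp add: sum_negf)
  ultimately show ?thesis by simp
qed

text \<open>
  A rotationally symmetric bump $w \mapsto e^{-1/(1-|w-c|^2/s^2)}$ on the ball, divided by its integral.
\<close>

lemma smooth_bump_exists:
  fixes c :: "'a::euclidean_space" and s :: real
  assumes "s > 0"
  obtains \<psi> :: "'a \<Rightarrow> real" where "smooth_fun \<psi>" "\<And>w. \<psi> w \<ge> 0"
    "\<And>w. w \<notin> cball c s \<Longrightarrow> \<psi> w = 0" "(\<integral>\<^sup>+ w. ennreal (\<psi> w) \<partial>lborel) = 1"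
proof -
  define \<psi>0 :: "'a \<Rightarrow> real" where
    "\<psi>0 w = poly_exp_cutoff 1 (1 - ((1/s) *\<^sub>R (w - c)) \<bullet> ((1/s) *\<^sub>R (w - c)))" for w
  have smooth: "Ck_fun k \<psi>0" for k
    unfolding \<psi>0_def
    using Ck_fun_affine[OF Ck_fun_compose[OF Ck_fun_poly_exp_cutoff Ck_fun_one_minus_norm_square], of k 1 "1/s" c]
    by simp
  have cont: "continuous_on UNIV \<psi>0" using smooth[of 0] by simp
  then have [measurable]: "\<psi>0 \<in> borel_measurable borel" by (rule borel_measurable_continuous_onI)
  have nn: "\<psi>0 w \<ge> 0" for w by (simp add: \<psi>0_def poly_exp_cutoff_def)
  have pos_iff: "\<psi>0 w > 0 \<longleftrightarrow> w \<in> ball c s" for w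
  proof -
    have "((1/s) *\<^sub>R (w - c)) \<bullet> ((1/s) *\<^sub>R (w - c)) = (norm (w - c) / s)\<^sup>2"
      by (simp only: inner_scaleR_left inner_scaleR_right dot_square_norm)
         (simp add: power2_eq_square)
    then have "\<psi>0 w > 0 \<longleftrightarrow> (norm (w - c) / s)\<^sup>2 < 1"
      by (simp add: \<psi>0_def poly_exp_cutoff_def)
    also have "\<dots> \<longleftrightarrow> w \<in> ball c s"
      using assms by (auto simp: dist_norm norm_minus_commute abs_square_less_1)
    finally show ?thesis .
  qed
  have zero: "\<psi>0 w = 0" if "w \<notin> ball c s" for w
    using pos_iff[of w] nn[of w] that by auto
  have le1: "\<psi>0 w \<le> 1" for w
    by (simp add: \<psi>0_def poly_exp_cutoff_def)
  define m where "m = (\<integral>\<^sup>+ w. ennreal (\<psi>0 w) \<partial>lborel)"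
  have "m \<le> (\<integral>\<^sup>+ w. indicator (ball c s) w \<partial>lborel)"
    unfolding m_def using le1 zero
    by (intro nn_integral_mono) (auto simp: indicator_def)
  also have "\<dots> < \<infinity>" using emeasure_lborel_ball_finite by auto
  finally have mfin: "m < \<infinity>" .
  have "m \<noteq> 0"
  proof
    assume "m = 0"
    then have "AE w in lborel. \<psi>0 w = 0"
      using nn by (simp add: m_def nn_integral_0_iff_AE ennreal_eq_0_iff antisym_conv)
    then have "AE w in lborel. w \<notin> ball c s"
      by eventually_elim (use pos_iff in force)
    then have "emeasure lborel (ball c s) = 0"
      by (subst (asm) AE_iff_measurable[of "ball c s"]) auto
    then have "measure lborel (ball c s) = 0" by (simp add: measure_def)
    then show False using content_ball_gt_0_iff[of c s] assms by simp
  qed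
  then obtain r where r: "m = ennreal r" "r > 0"
    using mfin by (cases m) (auto simp: ennreal_eq_0_iff)
  show ?thesis
  proof
    show "smooth_fun (\<lambda>w. (1 / r) * \<psi>0 w)"
      unfolding smooth_fun_def by (intro allI Ck_fun_mult Ck_fun_const smooth)
    show "(1 / r) * \<psi>0 w \<ge> 0" for w using nn r by simp
    show "(1 / r) * \<psi>0 w = 0" if "w \<notin> cball c s" for w using zero that by auto
    have "(\<integral>\<^sup>+ w. ennreal (1 / r * \<psi>0 w) \<partial>lborel) = ennreal (1 / r) * m"
      using r nn by (simp add: ennreal_mult nn_integral_cmult m_def del: times_divide_eq_left)
    also have "\<dots> = 1" using r by (simp flip: ennreal_mult)
    finally show "(\<integral>\<^sup>+ w. ennreal (1 / r * \<psi>0 w) \<partial>lborel) = 1" .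
  qed
qed

section \<open>Interior cones at a smooth boundary\<close>

lemma Ck_fun_1_Lipschitz_on_interval:
  fixes \<gamma> :: "real \<Rightarrow> real"
  assumes "Ck_fun (Suc 0) \<gamma>" "a \<le> b"
  obtains L where "L \<ge> 0" "\<And>s t. s \<in> {a..b} \<Longrightarrow> t \<in> {a..b} \<Longrightarrow> \<bar>\<gamma> s - \<gamma> t\<bar> \<le> L * \<bar>s - t\<bar>"
proof -
  let ?d = "\<lambda>x. frechet_derivative \<gamma> (at x) 1"
  have "continuous_on UNIV ?d" using assms by simp
  then have "compact (?d ` {a..b})"
    by (meson compact_Icc compact_continuous_image continuous_on_subset subset_UNIV)
  then obtain L where L: "\<And>x. x \<in> {a..b} \<Longrightarrow> norm (?d x) \<le> L"
    using compact_imp_bounded bounded_iff by (metis (no_types, lifting) imageI)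
  have "L \<ge> 0" using L[of a] assms norm_ge_zero order_trans by fastforce
  have der: "(\<gamma> has_real_derivative ?d x) (at x within {a..b})" for x
  proof -
    have "(\<gamma> has_derivative frechet_derivative \<gamma> (at x)) (at x)"
      using assms(1) by (auto simp: frechet_derivative_works)
    moreover have "frechet_derivative \<gamma> (at x) = (*) (?d x)"
    proof
      fix r
      have "linear (frechet_derivative \<gamma> (at x))"
        using assms(1) by (auto intro: linear_frechet_derivative)
      then show "frechet_derivative \<gamma> (at x) r = ?d x * r"
        using linear_cmul[of "frechet_derivative \<gamma> (at x)" r 1] by (simp add: mult.commute)
    qed
    ultimately show ?thesis
      by (simp add: has_field_derivative_def has_derivative_at_withinI)
  qed
  show ?thesis
  proof (rule that[OF \<open>L \<ge> 0\<close>])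
    fix s t assume "s \<in> {a..b}" "t \<in> {a..b}"
    then show "\<bar>\<gamma> s - \<gamma> t\<bar> \<le> L * \<bar>s - t\<bar>"
      using field_differentiable_bound[of "{a..b}" \<gamma> ?d L s t] der L by simp
  qed
qed

text \<open>
  The truncated cone is the union of the sets $x + t B$, $0 < t \leq 1$, where $B$ is the closed ball with centre $c$ and radius $s$.
  The same ball serves for all points $x$ of the set near $z$; $z$ itself may lie on the boundary.
\<close>

definition local_cone :: "'a::euclidean_space set \<Rightarrow> 'a \<Rightarrow> real \<Rightarrow> 'a \<Rightarrow> real \<Rightarrow> bool" where
  "local_cone \<Omega> z \<rho> c s \<longleftrightarrow> 0 < \<rho> \<and> 0 < s \<and>
     (\<forall>x \<in> \<Omega> \<inter> ball z \<rho>. \<forall>t. 0 < t \<and> t \<le> 1 \<longrightarrow> (\<forall>w \<in> cball c s. x + t *\<^sub>R w \<in> \<Omega>))"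

text \<open>
  At a boundary point the set is the epigraph of a function with some Lipschitz constant \<open>L\<close> in the frame
  $(u, v)$. A direction $w$ whose $v$-component exceeds \<open>L\<close> times its $u$-component leads upwards faster than
  the graph can rise, so moving along it from a point of the set stays in the set. Such directions contain a ball around
  a small multiple of $v$.
\<close>

lemma smooth_boundary_local_cone:
  assumes "open \<Omega>" "smooth_boundary \<Omega>" "z \<in> closure \<Omega>"
  shows "\<exists>\<rho> c s. local_cone \<Omega> z \<rho> c s"
proof (cases "z \<in> \<Omega>")
  case True
  then obtain e where e: "e > 0" "ball z e \<subseteq> \<Omega>" using assms(1) open_contains_ball by blast
  have "x + t *\<^sub>R w \<in> \<Omega>" if "x \<in> ball z (e/2)" "0 < t" "t \<le> 1" "w \<in> cball 0 (e/2)" for x t w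
  proof -
    have "dist z (x + t *\<^sub>R w) \<le> dist z x + norm (t *\<^sub>R w)"
      by (metis add_diff_cancel_left' dist_norm dist_triangle norm_minus_commute)
    moreover have "norm (t *\<^sub>R w) \<le> 1 * (e/2)"
      using that unfolding norm_scaleR by (intro mult_mono) auto
    ultimately show ?thesis using that e by force
  qed
  then show ?thesis using e unfolding local_cone_def
    by (intro exI[of _ "e/2"] exI[of _ "0"] exI[of _ "e/2"]) auto
next
  case False
  then have "z \<in> frontier \<Omega>" using assms by (simp add: frontier_def interior_open)
  then obtain r u v \<gamma> where r: "r > 0" and uv: "norm u = 1" "norm v = 1" "u \<bullet> v = 0"
    and \<gamma>: "smooth_fun \<gamma>"
    and epi: "\<Omega> \<inter> ball z r = {y \<in> ball z r. y \<bullet> v > \<gamma> (y \<bullet> u)}"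
    using assms(2) unfolding smooth_boundary_def by blast
  obtain L where L: "L \<ge> 0" "\<And>s t. s \<in> {z \<bullet> u - r..z \<bullet> u + r} \<Longrightarrow> t \<in> {z \<bullet> u - r..z \<bullet> u + r} \<Longrightarrow>
      \<bar>\<gamma> s - \<gamma> t\<bar> \<le> L * \<bar>s - t\<bar>"
  proof (rule Ck_fun_1_Lipschitz_on_interval)
    show "Ck_fun (Suc 0) \<gamma>" using \<gamma> by (simp only: smooth_fun_def)
    show "z \<bullet> u - r \<le> z \<bullet> u + r" using r by simp
  qed blast
  have coord: "y \<bullet> u \<in> {z \<bullet> u - r..z \<bullet> u + r}" if "y \<in> ball z r" for y
  proof -
    have "\<bar>(y - z) \<bullet> u\<bar> \<le> norm (y - z)"
      using Cauchy_Schwarz_ineq2[of "y - z" u] uv by simp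
    then show ?thesis using that by (auto simp: dist_norm norm_minus_commute inner_diff_left)
  qed
  define \<kappa> where "\<kappa> = r / 4"
  \<comment> \<open>The radius is small enough that \<open>L * s < \<kappa> - s\<close>: the directions in the ball are steeper than the graph.\<close>
  define s where "s = \<kappa> / (L + 2)"
  have s: "s > 0" "s \<le> \<kappa>" "L * s < \<kappa> - s"
    using r L(1) by (auto simp: s_def \<kappa>_def field_simps intro!: add_pos_nonneg)
  have "x + t *\<^sub>R w \<in> \<Omega>"
    if x: "x \<in> \<Omega>" "x \<in> ball z (r/2)" and t: "0 < t" "t \<le> 1" and w: "w \<in> cball (\<kappa> *\<^sub>R v) s" for x t w
  proof -
    have nw: "norm (w - \<kappa> *\<^sub>R v) \<le> s" using w by (simp add: dist_norm norm_minus_commute)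
    have "norm w \<le> 2 * \<kappa>"
      using norm_triangle_ineq[of "w - \<kappa> *\<^sub>R v" "\<kappa> *\<^sub>R v"] nw s uv r by (simp add: \<kappa>_def)
    have "dist z (x + t *\<^sub>R w) \<le> dist z x + norm (t *\<^sub>R w)"
      by (metis add_diff_cancel_left' dist_norm dist_triangle norm_minus_commute)
    moreover have "norm (t *\<^sub>R w) \<le> 1 * (2 * \<kappa>)"
      using t \<open>norm w \<le> 2 * \<kappa>\<close> unfolding norm_scaleR by (intro mult_mono) auto
    ultimately have yb: "x + t *\<^sub>R w \<in> ball z r" using x by (simp add: \<kappa>_def)
    have xb: "x \<in> ball z r" using x r by auto
    have xv: "x \<bullet> v > \<gamma> (x \<bullet> u)" using epi x xb by blast
    have "\<bar>(w - \<kappa> *\<^sub>R v) \<bullet> v\<bar> \<le> s" using Cauchy_Schwarz_ineq2[of "w - \<kappa> *\<^sub>R v" v] uv nw by simp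
    then have wv: "w \<bullet> v \<ge> \<kappa> - s"
      using uv by (simp add: inner_diff_left dot_square_norm)
    have "\<bar>(w - \<kappa> *\<^sub>R v) \<bullet> u\<bar> \<le> s" using Cauchy_Schwarz_ineq2[of "w - \<kappa> *\<^sub>R v" u] uv nw by simp
    then have wu: "\<bar>w \<bullet> u\<bar> \<le> s"
      using uv by (simp add: inner_diff_left inner_diff_right inner_commute)
    have "\<gamma> ((x + t *\<^sub>R w) \<bullet> u) \<le> \<gamma> (x \<bullet> u) + L * \<bar>t * (w \<bullet> u)\<bar>"
      using L(2)[OF coord[OF yb] coord[OF xb]] by (simp add: inner_add_left)
    also have "L * \<bar>t * (w \<bullet> u)\<bar> \<le> t * (L * s)"
      using mult_left_mono[OF wu, of "t * L"] L(1) t by (simp add: abs_mult mult_ac)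
    also have "t * (L * s) < t * (\<kappa> - s)" using t s by simp
    also have "t * (\<kappa> - s) \<le> t * (w \<bullet> v)" using wv t by simp
    finally have "\<gamma> ((x + t *\<^sub>R w) \<bullet> u) < (x + t *\<^sub>R w) \<bullet> v" using xv by (simp add: inner_add_left)
    then show ?thesis using epi yb by blast
  qed
  then show ?thesis using r s unfolding local_cone_def
    by (intro exI[of _ "r/2"] exI[of _ "\<kappa> *\<^sub>R v"] exI[of _ s]) auto
qed

section \<open>Hoelder's inequality and the Riesz potential in the plane\<close>

lemma weighted_AM_GM:
  fixes \<alpha> a :: "'i \<Rightarrow> real"
  assumes "finite I" "I \<noteq> {}" "\<And>i. i \<in> I \<Longrightarrow> \<alpha> i \<ge> 0" "sum \<alpha> I = 1" "\<And>i. i \<in> I \<Longrightarrow> a i \<ge> 0"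
  shows "(\<Prod>i\<in>I. a i powr \<alpha> i) \<le> (\<Sum>i\<in>I. \<alpha> i * a i)"
proof (cases "\<exists>i\<in>I. a i = 0")
  case True
  then have "(\<Prod>i\<in>I. a i powr \<alpha> i) = 0"
    using assms(1) by (simp add: Bex_def)
  also have "0 \<le> (\<Sum>i\<in>I. \<alpha> i * a i)"
    using assms by (intro sum_nonneg mult_nonneg_nonneg)
  finally show ?thesis .
next
  case False
  then have pos: "a i > 0" if "i \<in> I" for i using assms(5) that by force
  have "(\<Prod>i\<in>I. a i powr \<alpha> i) = (\<Prod>i\<in>I. exp (\<alpha> i *\<^sub>R ln (a i)))"
    by (intro prod.cong refl) (use pos in \<open>force simp: powr_def\<close>)
  also have "\<dots> = exp (\<Sum>i\<in>I. \<alpha> i *\<^sub>R ln (a i))" using assms by (simp add: exp_sum)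
  also have "\<dots> \<le> (\<Sum>i\<in>I. \<alpha> i * exp (ln (a i)))"
    using assms by (intro convex_on_sum[OF _ _ exp_convex]) auto
  also have "\<dots> = (\<Sum>i\<in>I. \<alpha> i * a i)" using pos by (intro sum.cong) auto
  finally show ?thesis .
qed

text \<open>
  Hoelder's inequality for finitely many factors with weights summing to 1, which is the weighted
  inequality of arithmetic and geometric means after division of every factor by the bound \<open>A i\<close> for its
  integral. If some bound is zero, that factor vanishes almost everywhere, and so does the product.
\<close>

lemma nn_integral_Hoelder:
  fixes \<alpha> A :: "'i \<Rightarrow> real" and a :: "'i \<Rightarrow> 'a \<Rightarrow> real"
  assumes I: "finite I" "I \<noteq> {}" "\<And>i. i \<in> I \<Longrightarrow> \<alpha> i \<ge> 0" "sum \<alpha> I = 1"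
    and meas [measurable]: "\<And>i. i \<in> I \<Longrightarrow> a i \<in> borel_measurable M"
    and nn: "\<And>i x. i \<in> I \<Longrightarrow> a i x \<ge> 0" "\<And>i. i \<in> I \<Longrightarrow> A i \<ge> 0"
    and le: "\<And>i. i \<in> I \<Longrightarrow> (\<integral>\<^sup>+ x. ennreal (a i x) \<partial>M) \<le> ennreal (A i)"
  shows "(\<integral>\<^sup>+ x. ennreal (\<Prod>i\<in>I. a i x powr \<alpha> i) \<partial>M) \<le> ennreal (\<Prod>i\<in>I. A i powr \<alpha> i)"
proof (cases "\<exists>i\<in>I. A i = 0")
  case True
  then obtain i where i: "i \<in> I" "A i = 0" by blast
  then have "AE x in M. a i x = 0"
    using le[OF i(1)] nn(1)[OF i(1)] meas[OF i(1)]
    by (simp add: nn_integral_0_iff_AE ennreal_eq_0_iff antisym_conv)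
  then have "AE x in M. ennreal (\<Prod>i\<in>I. a i x powr \<alpha> i) = 0"
  proof eventually_elim
    case (elim x)
    then have "(\<Prod>i\<in>I. a i x powr \<alpha> i) = 0" using i(1) I(1) by (intro prod_zero bexI[of _ i]) auto
    then show ?case by simp
  qed
  then have "(\<integral>\<^sup>+ x. ennreal (\<Prod>i\<in>I. a i x powr \<alpha> i) \<partial>M) = 0"
    by (subst nn_integral_cong_AE) auto
  then show ?thesis by simp
next
  case False
  then have pos: "A i > 0" if "i \<in> I" for i using nn(2) that by force
  define P where "P = (\<Prod>i\<in>I. A i powr \<alpha> i)"
  have P: "P > 0" using pos unfolding P_def by (intro prod_pos) force
  have pw: "(\<Prod>i\<in>I. a i x powr \<alpha> i) \<le> P * (\<Sum>i\<in>I. \<alpha> i / A i * a i x)" for x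
  proof -
    have "(\<Prod>i\<in>I. a i x powr \<alpha> i) = P * (\<Prod>i\<in>I. (a i x / A i) powr \<alpha> i)"
      using P by (simp add: powr_divide prod_dividef pos less_imp_le nn flip: P_def)
    also have "\<dots> \<le> P * (\<Sum>i\<in>I. \<alpha> i * (a i x / A i))"
      using P I nn pos by (intro mult_left_mono weighted_AM_GM) (auto simp: less_imp_le)
    finally show ?thesis by simp
  qed
  have "(\<integral>\<^sup>+ x. ennreal (\<Prod>i\<in>I. a i x powr \<alpha> i) \<partial>M)
      \<le> (\<integral>\<^sup>+ x. ennreal P * (\<Sum>i\<in>I. ennreal (\<alpha> i / A i) * ennreal (a i x)) \<partial>M)"
  proof (rule nn_integral_mono)
    fix x
    have "ennreal (\<Prod>i\<in>I. a i x powr \<alpha> i) \<le> ennreal (P * (\<Sum>i\<in>I. \<alpha> i / A i * a i x))"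
      by (rule ennreal_leI[OF pw])
    also have "\<dots> = ennreal P * (\<Sum>i\<in>I. ennreal (\<alpha> i / A i) * ennreal (a i x))"
    proof -
      have *: "0 \<le> \<alpha> i / A i" if "i \<in> I" for i using that I(3) nn(2) by simp
      have "ennreal (\<Sum>i\<in>I. \<alpha> i / A i * a i x) = (\<Sum>i\<in>I. ennreal (\<alpha> i / A i * a i x))"
        using * nn(1) by (intro sum_ennreal[symmetric] mult_nonneg_nonneg)
      also have "\<dots> = (\<Sum>i\<in>I. ennreal (\<alpha> i / A i) * ennreal (a i x))"
        using * nn(1) by (intro sum.cong refl ennreal_mult) auto
      finally show ?thesis using P by (simp add: ennreal_mult')
    qed
    finally show "ennreal (\<Prod>i\<in>I. a i x powr \<alpha> i) \<le> ennreal P * (\<Sum>i\<in>I. ennreal (\<alpha> i / A i) * ennreal (a i x))" .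
  qed
  also have "\<dots> = ennreal P * (\<Sum>i\<in>I. ennreal (\<alpha> i / A i) * (\<integral>\<^sup>+ x. ennreal (a i x) \<partial>M))"
    by (simp add: nn_integral_cmult nn_integral_sum)
  also have "\<dots> \<le> ennreal P * (\<Sum>i\<in>I. ennreal (\<alpha> i / A i) * ennreal (A i))"
    by (intro mult_left_mono sum_mono le) auto
  also have "(\<Sum>i\<in>I. ennreal (\<alpha> i / A i) * ennreal (A i)) = (\<Sum>i\<in>I. ennreal (\<alpha> i))"
    using pos I by (intro sum.cong refl) (force simp flip: ennreal_mult'')
  also have "\<dots> = 1" using I by (simp add: sum_ennreal)
  finally show ?thesis by (simp add: P_def)
qed

text \<open>
  This controls the sum of the geometric series with ratio $2^{-1/m}$ by $2m$, through Bernoulli's inequality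
  for the $m$-th power of $1 - 1/(2m)$.
\<close>

lemma geometric_ratio_bound:
  assumes "m \<ge> 1" shows "1 - (2::real) powr (- (1 / real m)) \<ge> 1 / (2 * real m)"
proof -
  have "1 + real m * (- (1 / (2 * real m))) \<le> (1 + (- (1 / (2 * real m)))) ^ m"
    using assms by (intro Bernoulli_inequality) (auto simp: field_simps)
  then have "1 / 2 \<le> (1 - 1 / (2 * real m)) ^ m" using assms by simp
  also have pos: "1 - 1 / (2 * real m) > 0" using assms by (simp add: field_simps)
  then have "(1 - 1 / (2 * real m)) ^ m = (1 - 1 / (2 * real m)) powr real m"
    by (simp add: powr_realpow)
  finally have "(1 / 2) powr (1 / real m) \<le> ((1 - 1 / (2 * real m)) powr real m) powr (1 / real m)"
    by (intro powr_mono2) auto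
  also have "\<dots> = 1 - 1 / (2 * real m)" using pos assms by (simp add: powr_powr)
  also have "(1 / 2) powr (1 / real m) = (2::real) powr (- (1 / real m))"
    by (simp add: powr_minus powr_divide inverse_eq_divide)
  finally show ?thesis by linarith
qed

lemma dyadic_scale_exists:
  fixes D r :: real
  assumes "0 < r" "r < D"
  obtains j :: nat where "D / 2 ^ Suc j \<le> r" "r < D / 2 ^ j"
proof -
  have "\<exists>n. D / 2 ^ n \<le> r"
  proof -
    obtain n where "(1/2) ^ n < r / D"
      using real_arch_pow_inv[of "r / D" "1/2"] assms by auto
    then show ?thesis using assms by (intro exI[of _ n]) (simp add: field_simps)
  qed
  define n where "n = (LEAST n. D / 2 ^ n \<le> r)"
  have n: "D / 2 ^ n \<le> r" unfolding n_def by (rule LeastI_ex) fact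
  have "n \<noteq> 0" using n assms by (cases n) auto
  then obtain j where j: "n = Suc j" by (cases n) auto
  have "\<not> D / 2 ^ j \<le> r" using not_less_Least[of j "\<lambda>n. D / 2 ^ n \<le> r"] j n_def by auto
  then show ?thesis using that[of j] n j by simp
qed

text \<open>
  On the dyadic annulus with radii $D/2^{j+1}$ and $D/2^j$ the kernel is comparable to $(D/2^j)^{-(2-1/m)}$ and the
  area to $(D/2^j)^2$, so the integral is a geometric series with ratio $2^{-1/m}$, whose sum is of
  order $m$.
\<close>

lemma Riesz_kernel_bound:
  fixes D :: real
  assumes "D > 0"
  obtains K :: real where "K > 0"
    "\<And>m (x::real^2). m \<ge> 1 \<Longrightarrow>
       (\<integral>\<^sup>+ y. ennreal (norm (x - y) powr (- (2 - 1 / real m))) * indicator (ball x D) y \<partial>lborel)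
         \<le> ennreal (K * real m)"
proof
  define K where "K = 8 * max 1 D * pi"
  show "K > 0" by (simp add: K_def)
  fix m :: nat and x :: "real^2" assume m: "m \<ge> 1"
  define a where "a = 2 - 1 / real m"
  have a: "1 \<le> a" "a < 2" using m by (auto simp: a_def field_simps)
  have 1: "ennreal (norm (x - y) powr (- a)) * indicator (ball x D) y
      \<le> (\<Sum>j. ennreal ((D / 2 ^ Suc j) powr (- a)) * indicator (ball x (D / 2 ^ j)) y)" for y
  proof (cases "y \<in> ball x D \<and> y \<noteq> x")
    case True
    then obtain j where j: "D / 2 ^ Suc j \<le> norm (x - y)" "norm (x - y) < D / 2 ^ j"
      using dyadic_scale_exists[of "norm (x - y)" D] by (auto simp: dist_norm)
    have "ennreal (norm (x - y) powr (- a)) * indicator (ball x D) y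
        \<le> ennreal ((D / 2 ^ Suc j) powr (- a)) * indicator (ball x (D / 2 ^ j)) y"
      using j True a assms by (auto simp: dist_norm indicator_def intro!: ennreal_leI powr_mono2')
    also have "\<dots> = (\<Sum>j\<in>{j}. ennreal ((D / 2 ^ Suc j) powr (- a)) * indicator (ball x (D / 2 ^ j)) y)"
      by (subst sum.insert) auto
    also have "\<dots> \<le> (\<Sum>j. ennreal ((D / 2 ^ Suc j) powr (- a)) * indicator (ball x (D / 2 ^ j)) y)"
      by (rule sum_le_suminf) auto
    finally show ?thesis .
  qed (auto simp: indicator_def)
  define c where "c = 2 powr a * D powr (- a) * pi * D\<^sup>2"
  have ball: "ennreal ((D / 2 ^ Suc j) powr (- a)) * emeasure lborel (ball x (D / 2 ^ j))
      = ennreal (c * (2 powr (- (1 / real m))) ^ j)" for j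
  proof -
    have "(D / 2 ^ Suc j) powr (- a) = D powr (- a) * (2 powr a * 2 powr (a * real j))"
    proof -
      have "(2::real) ^ Suc j = 2 powr (1 + real j)" by (simp add: powr_add powr_realpow)
      then show ?thesis using assms
        by (simp add: powr_divide powr_powr powr_minus field_simps flip: powr_add)
    qed
    moreover have "(2::real) powr (a * real j) = (2 powr (- (1 / real m))) ^ j * (2 ^ j)\<^sup>2"
    proof -
      have "(2::real) powr (a * real j) / (2 ^ j)\<^sup>2 = 2 powr (a * real j) / 2 powr (2 * real j)"
        by (simp add: powr_realpow[symmetric] power2_eq_square flip: powr_add)
      also have "\<dots> = 2 powr (- (1 / real m) * real j)"
        by (simp add: a_def algebra_simps flip: powr_diff)
      also have "\<dots> = (2 powr (- (1 / real m))) ^ j" by (subst powr_powr[symmetric], subst powr_realpow) auto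
      finally show ?thesis by (simp add: divide_eq_eq)
    qed
    moreover have "emeasure lborel (ball x (D / 2 ^ j)) = ennreal (pi * (D / 2 ^ j)\<^sup>2)"
      using assms by (subst emeasure_ball) (auto simp: eval_unit_ball_vol)
    ultimately show ?thesis
      by (simp add: c_def power_divide ennreal_mult'[symmetric] mult_ac)
  qed
  let ?r = "(2::real) powr (- (1 / real m))"
  have r: "0 < ?r" "?r < 1" "1 / (2 * real m) \<le> 1 - ?r"
    using m geometric_ratio_bound[OF m] by (auto simp: powr_less_one)
  have "D powr (- a) * D\<^sup>2 = D powr (2 - a)"
    using powr_add[of D "- a" 2] assms by (simp add: powr_numeral)
  also have "\<dots> \<le> max 1 D powr (2 - a)" using a assms by (intro powr_mono2) auto
  also have "\<dots> \<le> max 1 D powr 1" using a by (intro powr_mono) auto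
  finally have D: "D powr (- a) * D\<^sup>2 \<le> max 1 D" by simp
  have "(2::real) powr a \<le> 2 powr 2" using a by (intro powr_mono) auto
  then have "2 powr a * (D powr (- a) * D\<^sup>2) * pi \<le> 4 * max 1 D * pi"
    using D by (intro mult_right_mono mult_mono) auto
  then have c: "c \<ge> 0" "2 * c \<le> K"
    by (auto simp: c_def K_def mult_ac)
  have "(\<integral>\<^sup>+ y. ennreal (norm (x - y) powr (- a)) * indicator (ball x D) y \<partial>lborel)
      \<le> (\<integral>\<^sup>+ y. (\<Sum>j. ennreal ((D / 2 ^ Suc j) powr (- a)) * indicator (ball x (D / 2 ^ j)) y) \<partial>lborel)"
    by (intro nn_integral_mono 1)
  also have "\<dots> = (\<Sum>j. ennreal (c * ?r ^ j))"
    by (subst nn_integral_suminf) (simp_all only: nn_integral_cmult_indicator ball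
        sets_lborel borel_measurable_indicator borel_measurable_times_ennreal borel_measurable_const
        open_ball borel_open)
  also have "\<dots> = ennreal (\<Sum>j. c * ?r ^ j)"
  proof (rule suminf_ennreal2)
    show "0 \<le> c * ?r ^ j" for j using r c by (intro mult_nonneg_nonneg zero_le_power) linarith+
    show "summable (\<lambda>j. c * ?r ^ j)" using r by (intro summable_mult summable_geometric) auto
  qed
  also have "(\<Sum>j. c * ?r ^ j) = c * (1 / (1 - ?r))"
    using r suminf_geometric[of ?r] by (subst suminf_mult) (auto intro!: summable_geometric)
  also have "ennreal \<dots> \<le> ennreal (c * (2 * real m))"
  proof (intro ennreal_leI mult_left_mono)
    have "1 / (1 - ?r) \<le> 1 / (1 / (2 * real m))"
      using r m by (intro divide_left_mono mult_pos_pos) auto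
    then show "1 / (1 - ?r) \<le> 2 * real m" by simp
  qed (use c in simp)
  also have "\<dots> \<le> ennreal (K * real m)"
    using mult_right_mono[OF c(2), of "real m"] by (intro ennreal_leI) (simp add: mult_ac)
  finally show "(\<integral>\<^sup>+ y. ennreal (norm (x - y) powr (- (2 - 1 / real m))) * indicator (ball x D) y \<partial>lborel)
         \<le> ennreal (K * real m)" by (simp add: a_def)
qed

text \<open>
  With these rules, Borel functions of several points are measurable for products of
  Lebesgue measures on subsets.
\<close>

lemma fst_snd_borel_lebesgue_on:
  fixes \<Omega> :: "'a::euclidean_space set"
  shows "(\<lambda>x. x) \<in> borel_measurable (lebesgue_on \<Omega>)"
    "fst \<in> borel_measurable (lebesgue_on \<Omega> \<Otimes>\<^sub>M N)"
    "snd \<in> borel_measurable (N \<Otimes>\<^sub>M lebesgue_on \<Omega>)"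
proof -
  show 1: "(\<lambda>x. x) \<in> borel_measurable (lebesgue_on \<Omega>)"
    by (intro measurable_restrict_space1 measurable_completion) simp
  show "fst \<in> borel_measurable (lebesgue_on \<Omega> \<Otimes>\<^sub>M N)"
    by (rule measurable_compose[OF measurable_fst 1])
  show "snd \<in> borel_measurable (N \<Otimes>\<^sub>M lebesgue_on \<Omega>)"
    by (rule measurable_compose[OF measurable_snd 1])
qed

lemma Riesz_kernel_bound_on:
  fixes \<Omega> :: "(real^2) set"
  assumes "bounded \<Omega>" "\<Omega> \<in> sets lebesgue"
  obtains K :: real where "K > 0"
    "\<And>m x. m \<ge> 1 \<Longrightarrow> x \<in> \<Omega> \<Longrightarrow>
       (\<integral>\<^sup>+ y. ennreal (norm (x - y) powr (- (2 - 1 / real m))) \<partial>lebesgue_on \<Omega>) \<le> ennreal (K * real m)"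
proof -
  obtain D where D: "D > 0" "\<And>x y. x \<in> \<Omega> \<Longrightarrow> y \<in> \<Omega> \<Longrightarrow> y \<in> ball x D"
  proof -
    obtain e where e: "\<forall>x\<in>\<Omega>. \<forall>y\<in>\<Omega>. dist x y \<le> e"
      using assms(1) unfolding bounded_two_points by (rule exE)
    show ?thesis
    proof (rule that[of "max 1 (e + 1)"])
      fix x y assume "x \<in> \<Omega>" "y \<in> \<Omega>"
      then have "dist x y \<le> e" using e by simp
      then show "y \<in> ball x (max 1 (e + 1))" by simp
    qed simp
  qed
  obtain K where K: "K > 0" and bd: "\<And>m (x::real^2). m \<ge> 1 \<Longrightarrow>
       (\<integral>\<^sup>+ y. ennreal (norm (x - y) powr (- (2 - 1 / real m))) * indicator (ball x D) y \<partial>lborel)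
         \<le> ennreal (K * real m)"
    by (rule Riesz_kernel_bound[OF D(1)]) blast
  show ?thesis
  proof (rule that[OF K])
    fix m :: nat and x assume m: "m \<ge> 1" and x: "x \<in> \<Omega>"
    let ?k = "\<lambda>y. ennreal (norm (x - y) powr (- (2 - 1 / real m)))"
    have "(\<integral>\<^sup>+ y. ?k y \<partial>lebesgue_on \<Omega>) = (\<integral>\<^sup>+ y. ?k y * indicator \<Omega> y \<partial>lebesgue)"
      using assms(2) by (subst nn_integral_restrict_space) auto
    also have "\<dots> \<le> (\<integral>\<^sup>+ y. ?k y * indicator (ball x D) y \<partial>lebesgue)"
      using D(2)[OF x] by (intro nn_integral_mono) (auto simp: indicator_def)
    also have "\<dots> = (\<integral>\<^sup>+ y. ?k y * indicator (ball x D) y \<partial>lborel)"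
      by (intro nn_integral_completion) measurable
    also have "\<dots> \<le> ennreal (K * real m)" by (rule bd[OF m])
    finally show "(\<integral>\<^sup>+ y. ?k y \<partial>lebesgue_on \<Omega>) \<le> ennreal (K * real m)" .
  qed
qed

text \<open>
  With $k = 1/|x-y|$, the factorisation $G k = (G^2 k)^{1/(2m)} (G^2)^{1/2 - 1/(2m)} (k^{2-1/m})^{1/2}$ and
  Hoelder's inequality bound the $2m$-th power of the potential at $x$ by
  $\int G^2 k \cdot T^{m-1} (Km)^m$. Integrating in $x$ leaves only $\int G^2 k$, where Tonelli's theorem and the
  integrability of $k$ itself finish the proof.
\<close>

lemma Riesz_potential_power_integral:
  fixes \<Omega> :: "(real^2) set"
  assumes "bounded \<Omega>" "\<Omega> \<in> sets lebesgue"
  obtains K :: real where "K > 0"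
    "\<And>m G T. m \<ge> 1 \<Longrightarrow> G \<in> borel_measurable (lebesgue_on \<Omega>) \<Longrightarrow> (\<And>y. G y \<ge> 0) \<Longrightarrow> T \<ge> 0 \<Longrightarrow>
       (\<integral>\<^sup>+ y. ennreal ((G y)\<^sup>2) \<partial>lebesgue_on \<Omega>) \<le> ennreal T \<Longrightarrow>
       (\<integral>\<^sup>+ x. (\<integral>\<^sup>+ y. ennreal (G y / norm (x - y)) \<partial>lebesgue_on \<Omega>) ^ (2 * m) \<partial>lebesgue_on \<Omega>)
         \<le> ennreal (K * (K * real m * T) ^ m)"
proof -
  define M where "M = lebesgue_on \<Omega>"
  have spM: "space M = \<Omega>" by (simp add: M_def)
  interpret M: finite_measure M unfolding M_def
    using assms by (intro finite_measure_lebesgue_on bounded_set_imp_lmeasurable)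
  interpret MM: pair_sigma_finite M M ..
  note [measurable] = fst_snd_borel_lebesgue_on[where \<Omega>=\<Omega>, folded M_def]
  obtain K where K: "K > 0" and bd: "\<And>m x. m \<ge> 1 \<Longrightarrow> x \<in> \<Omega> \<Longrightarrow>
       (\<integral>\<^sup>+ y. ennreal (norm (x - y) powr (- (2 - 1 / real m))) \<partial>M) \<le> ennreal (K * real m)"
    unfolding M_def by (rule Riesz_kernel_bound_on[OF assms]) blast
  show ?thesis
  proof (rule that[OF K], fold M_def)
    fix m :: nat and G :: "real^2 \<Rightarrow> real" and T :: real
    assume m: "m \<ge> 1" and G [measurable]: "G \<in> borel_measurable M" and G0: "\<And>y. G y \<ge> 0" and T: "T \<ge> 0"
      and GT: "(\<integral>\<^sup>+ y. ennreal ((G y)\<^sup>2) \<partial>M) \<le> ennreal T"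
    define E where "E x = (\<integral>\<^sup>+ y. ennreal ((G y)\<^sup>2 / norm (x - y)) \<partial>M)" for x
    have [measurable]: "E \<in> borel_measurable M" unfolding E_def by measurable
    have "(\<integral>\<^sup>+ x. E x \<partial>M) = (\<integral>\<^sup>+ y. (\<integral>\<^sup>+ x. ennreal ((G y)\<^sup>2 / norm (x - y)) \<partial>M) \<partial>M)"
      unfolding E_def by (rule MM.Fubini'[symmetric]) measurable
    also have "\<dots> \<le> (\<integral>\<^sup>+ y. ennreal ((G y)\<^sup>2) * ennreal K \<partial>M)"
    proof (rule nn_integral_mono)
      fix y assume "y \<in> space M"
      then have y: "y \<in> \<Omega>" by (simp add: spM)
      have "(\<integral>\<^sup>+ x. ennreal ((G y)\<^sup>2 / norm (x - y)) \<partial>M)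
          = (\<integral>\<^sup>+ x. ennreal ((G y)\<^sup>2) * ennreal (norm (y - x) powr (- (2 - 1 / real 1))) \<partial>M)"
        by (intro nn_integral_cong)
           (simp add: ennreal_mult[symmetric] powr_minus powr_one divide_inverse norm_minus_commute)
      also have "\<dots> = ennreal ((G y)\<^sup>2) * (\<integral>\<^sup>+ x. ennreal (norm (y - x) powr (- (2 - 1 / real 1))) \<partial>M)"
        by (rule nn_integral_cmult) measurable
      also have "\<dots> \<le> ennreal ((G y)\<^sup>2) * ennreal K"
        using bd[of 1 y] y by (intro mult_left_mono) auto
      finally show "(\<integral>\<^sup>+ x. ennreal ((G y)\<^sup>2 / norm (x - y)) \<partial>M) \<le> ennreal ((G y)\<^sup>2) * ennreal K" .
    qed
    also have "\<dots> = (\<integral>\<^sup>+ y. ennreal ((G y)\<^sup>2) \<partial>M) * ennreal K"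
      by (rule nn_integral_multc) measurable
    also have "\<dots> \<le> ennreal T * ennreal K" using GT by (intro mult_right_mono) auto
    also have "\<dots> = ennreal (K * T)" using K T by (simp add: ennreal_mult mult.commute)
    finally have EK: "(\<integral>\<^sup>+ x. E x \<partial>M) \<le> ennreal (K * T)" .
    then have Efin: "AE x in M. E x \<noteq> \<infinity>"
      by (intro nn_integral_PInf_AE) (auto simp: top_unique)
    let ?I = "\<lambda>x. \<integral>\<^sup>+ y. ennreal (G y / norm (x - y)) \<partial>M"
    define B where "B = T powr (real m - 1) * (K * real m) ^ m"
    have B0: "B \<ge> 0" using K by (simp add: B_def)
    have pt: "?I x ^ (2 * m) \<le> E x * ennreal B" if "E x \<noteq> \<infinity>" "x \<in> \<Omega>" for x
    proof -
      obtain e where e: "E x = ennreal e" "e \<ge> 0" using \<open>E x \<noteq> \<infinity>\<close> by (cases "E x") auto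
      define a where "a = (\<lambda>i::nat. \<lambda>y. if i = 0 then (G y)\<^sup>2 / norm (x - y) else if i = 1 then (G y)\<^sup>2
          else norm (x - y) powr (- (2 - 1 / real m)))"
      define A where "A = (\<lambda>i::nat. if i = 0 then e else if i = 1 then T else K * real m)"
      define \<alpha> where "\<alpha> = (\<lambda>i::nat. if i = 0 then 1 / (2 * real m) else if i = 1 then 1/2 - 1 / (2 * real m) else 1/2)"
      have "(\<integral>\<^sup>+ y. ennreal (\<Prod>i\<in>{0,1,2}. a i y powr \<alpha> i) \<partial>M) \<le> ennreal (\<Prod>i\<in>{0,1,2}. A i powr \<alpha> i)"
      proof (rule nn_integral_Hoelder)
        show "\<alpha> i \<ge> 0" for i using m by (auto simp: \<alpha>_def field_simps)
        show "sum \<alpha> {0, 1, 2} = 1" by (simp add: \<alpha>_def)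
        show "a i \<in> borel_measurable M" for i unfolding a_def by measurable
        show "a i y \<ge> 0" for i y by (simp add: a_def)
        show "A i \<ge> 0" for i using e T K by (simp add: A_def)
        show "(\<integral>\<^sup>+ y. ennreal (a i y) \<partial>M) \<le> ennreal (A i)" if "i \<in> {0, 1, 2}" for i
          using e GT bd[OF m \<open>x \<in> \<Omega>\<close>] that unfolding a_def A_def E_def by auto
      qed auto
      also have "(\<lambda>y. \<Prod>i\<in>{0,1,2}. a i y powr \<alpha> i) = (\<lambda>y. G y / norm (x - y))"
      proof
        fix y
        show "(\<Prod>i\<in>{0,1,2}. a i y powr \<alpha> i) = G y / norm (x - y)"
        proof (cases "G y = 0 \<or> x = y")
          case True
          then show ?thesis by (auto simp: a_def)
        next
          case False
          define g where "g = ln (G y)"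
          define n where "n = ln (norm (x - y))"
          have g: "G y = exp g" using False G0[of y] by (auto simp: g_def)
          have n: "norm (x - y) = exp n" using False by (auto simp: n_def)
          have "a 0 y = exp (2 * g - n)" "a 1 y = exp (2 * g)" "a 2 y = exp (- (2 - 1 / real m) * n)"
            using False by (auto simp: a_def g n exp_diff powr_def exp_double)
          then have "(\<Prod>i\<in>{0,1,2}. a i y powr \<alpha> i)
              = exp ((2 * g - n) * \<alpha> 0) * (exp (2 * g * \<alpha> 1) * exp (- (2 - 1 / real m) * n * \<alpha> 2))"
            by (simp add: exp_powr_real)
          also have "\<dots> = exp ((2 * g - n) * \<alpha> 0 + 2 * g * \<alpha> 1 + (- (2 - 1 / real m) * n) * \<alpha> 2)"
            by (simp only: exp_add mult.assoc)
          also have "(2 * g - n) * \<alpha> 0 + 2 * g * \<alpha> 1 + (- (2 - 1 / real m) * n) * \<alpha> 2 = g - n"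
            using m by (simp add: \<alpha>_def field_simps)
          finally show ?thesis by (simp add: g n exp_diff)
        qed
      qed
      finally have "?I x \<le> ennreal (\<Prod>i\<in>{0,1,2}. A i powr \<alpha> i)" .
      then have "?I x ^ (2 * m) \<le> ennreal (\<Prod>i\<in>{0,1,2}. A i powr \<alpha> i) ^ (2 * m)"
        by (rule power_mono) simp
      also have "\<dots> = ennreal ((\<Prod>i\<in>{0,1,2}. A i powr \<alpha> i) ^ (2 * m))"
        by (rule ennreal_power) (auto intro: prod_nonneg)
      also have "(\<Prod>i\<in>{0,1,2}. A i powr \<alpha> i) ^ (2 * m) = (\<Prod>i\<in>{0,1,2}. A i powr (\<alpha> i * real (2 * m)))"
      proof -
        have "(r powr s) ^ (2 * m) = r powr (s * real (2 * m))" for r s :: real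
        proof (cases "r = 0")
          case False
          then have "r powr s > 0" by simp
          from powr_realpow[OF this, of "2 * m"] show ?thesis by (simp only: powr_powr)
        qed (use m in simp)
        then show ?thesis by (simp only: prod_power_distrib)
      qed
      also have "\<dots> = e * B"
      proof -
        have "\<alpha> 0 * real (2 * m) = 1" "\<alpha> 1 * real (2 * m) = real m - 1" "\<alpha> 2 * real (2 * m) = real m"
          using m by (simp_all add: \<alpha>_def left_diff_distrib)
        moreover have "(K * real m) powr real m = (K * real m) ^ m"
          using K m by (intro powr_realpow) auto
        moreover have "(\<Prod>i\<in>{0,1,2}. h i) = h 0 * (h 1 * h 2)" for h :: "nat \<Rightarrow> real" by simp
        moreover have "A 0 = e" "A 1 = T" "A 2 = K * real m" by (simp_all add: A_def)
        ultimately have "(\<Prod>i\<in>{0,1,2}. A i powr (\<alpha> i * real (2 * m)))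
            = e powr 1 * (T powr (real m - 1) * (K * real m) ^ m)"
          by (simp only:)
        then show ?thesis using e by (simp add: B_def)
      qed
      also have "ennreal (e * B) = E x * ennreal B" using e B0 by (simp add: ennreal_mult)
      finally show ?thesis .
    qed
    have "AE x in M. ?I x ^ (2 * m) \<le> E x * ennreal B"
      using Efin AE_space by eventually_elim (use pt spM in auto)
    then have "(\<integral>\<^sup>+ x. ?I x ^ (2 * m) \<partial>M) \<le> (\<integral>\<^sup>+ x. E x * ennreal B \<partial>M)"
      by (rule nn_integral_mono_AE)
    also have "\<dots> = (\<integral>\<^sup>+ x. E x \<partial>M) * ennreal B" by (rule nn_integral_multc) measurable
    also have "\<dots> \<le> ennreal (K * T) * ennreal B" using EK by (rule mult_right_mono) simp
    also have "\<dots> = ennreal (K * (K * real m * T) ^ m)"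
    proof -
      have "T * T powr (real m - 1) = T ^ m"
        using m T by (cases "T = 0") (auto simp: powr_diff powr_realpow)
      then have "K * T * B = K * (T ^ m * (K * real m) ^ m)"
        unfolding B_def by (metis (no_types) mult.assoc)
      also have "\<dots> = K * (K * real m * T) ^ m"
        by (subst power_mult_distrib[of "K * real m"]) simp
      finally show ?thesis using K T B0 by (simp add: ennreal_mult[symmetric])
    qed
    finally show "(\<integral>\<^sup>+ x. ?I x ^ (2 * m) \<partial>M) \<le> ennreal (K * (K * real m * T) ^ m)" .
  qed
qed

section \<open>Averages over a cone and the gradient\<close>

text \<open>
  The condition under which the order of integration is exchanged below, both between space and scale
  and between two points of the domain.
\<close>

lemma (in pair_sigma_finite) integrable_times_bounded_kernel:
  fixes f :: "'a \<Rightarrow> real" and k :: "'a \<Rightarrow> 'b \<Rightarrow> real"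
  assumes f: "integrable M1 f"
    and k [measurable]: "(\<lambda>(x, y). k x y) \<in> borel_measurable (M1 \<Otimes>\<^sub>M M2)"
    and bd: "\<And>x y. x \<in> space M1 \<Longrightarrow> y \<in> space M2 \<Longrightarrow> \<bar>k x y\<bar> \<le> C * indicator A y"
    and A [measurable]: "A \<in> sets M2" and fin: "emeasure M2 A < \<infinity>"
  shows "integrable (M1 \<Otimes>\<^sub>M M2) (\<lambda>(x, y). f x * k x y)"
proof (rule integrableI_bounded)
  have [measurable]: "f \<in> borel_measurable M1" using f by (rule borel_measurable_integrable)
  show "(\<lambda>(x, y). f x * k x y) \<in> borel_measurable (M1 \<Otimes>\<^sub>M M2)" by measurable
  have "(\<integral>\<^sup>+ p. ennreal (norm (case p of (x, y) \<Rightarrow> f x * k x y)) \<partial>(M1 \<Otimes>\<^sub>M M2))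
      = (\<integral>\<^sup>+ x. \<integral>\<^sup>+ y. ennreal (norm (f x * k x y)) \<partial>M2 \<partial>M1)"
    by (subst M2.nn_integral_fst[symmetric]) (simp_all, measurable)
  also have "\<dots> \<le> (\<integral>\<^sup>+ x. \<integral>\<^sup>+ y. ennreal \<bar>f x\<bar> * ennreal \<bar>C\<bar> * indicator A y \<partial>M2 \<partial>M1)"
  proof (intro nn_integral_mono)
    fix x y assume xy: "x \<in> space M1" "y \<in> space M2"
    have "\<bar>k x y\<bar> \<le> \<bar>C\<bar> * indicator A y"
      using bd[OF xy] by (auto simp: indicator_def split: if_splits)
    then have "norm (f x * k x y) \<le> \<bar>f x\<bar> * (\<bar>C\<bar> * indicator A y)"
      unfolding real_norm_def abs_mult by (intro mult_left_mono) auto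
    then have "ennreal (norm (f x * k x y)) \<le> ennreal (\<bar>f x\<bar> * (\<bar>C\<bar> * indicator A y))"
      by (rule ennreal_leI)
    also have "\<dots> = ennreal \<bar>f x\<bar> * ennreal \<bar>C\<bar> * indicator A y"
      by (simp add: ennreal_mult ennreal_indicator mult.assoc)
    finally show "ennreal (norm (f x * k x y)) \<le> ennreal \<bar>f x\<bar> * ennreal \<bar>C\<bar> * indicator A y" .
  qed
  also have "\<dots> = (\<integral>\<^sup>+ x. ennreal \<bar>f x\<bar> * (ennreal \<bar>C\<bar> * emeasure M2 A) \<partial>M1)"
    by (simp only: nn_integral_cmult_indicator[OF A] mult.assoc[symmetric])
  also have "\<dots> = (\<integral>\<^sup>+ x. ennreal \<bar>f x\<bar> \<partial>M1) * (ennreal \<bar>C\<bar> * emeasure M2 A)"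
    by (rule nn_integral_multc) measurable
  also have "\<dots> < \<infinity>"
    using f fin by (simp add: integrable_iff_bounded ennreal_mult_less_top)
  finally show "(\<integral>\<^sup>+ p. ennreal (norm (case p of (x, y) \<Rightarrow> f x * k x y)) \<partial>(M1 \<Otimes>\<^sub>M M2)) < \<infinity>" .
qed

text \<open>
  The fields below have length at most a multiple of $|x-y|\, t^{-3}$ at the scales $t$ above a multiple \<open>r\<close> of $|x-y|$ and
  vanish at smaller scales; the integral over all scales is then at most a multiple of $1/|x-y|$.
\<close>

lemma nn_integral_cube_tail:
  assumes "0 < (r::real)"
  shows "(\<integral>\<^sup>+ t. ennreal (1 / t ^ 3) * indicator {r..} t \<partial>lborel) = ennreal (1 / (2 * r\<^sup>2))"
proof -
  have "(\<integral>\<^sup>+ t. ennreal (1 / t ^ 3) * indicator {r..} t \<partial>lborel) = ennreal (0 - (- (1 / (2 * r\<^sup>2))))"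
  proof (rule nn_integral_FTC_atLeast)
    fix t assume "r \<le> t"
    then show "((\<lambda>t. - (1 / (2 * t\<^sup>2))) has_real_derivative 1 / t ^ 3) (at t)"
      using assms by (auto intro!: derivative_eq_intros simp: power2_eq_square power3_eq_cube field_simps)
    show "0 \<le> 1 / t ^ 3" using assms \<open>r \<le> t\<close> by simp
  next
    show "((\<lambda>t. - (1 / (2 * t\<^sup>2))) \<longlongrightarrow> (0::real)) at_top"
    proof -
      have "((\<lambda>t::real. - (1 / 2) * (inverse t)\<^sup>2) \<longlongrightarrow> - (1 / 2) * 0\<^sup>2) at_top"
        by (intro tendsto_intros tendsto_inverse_0_at_top filterlim_ident)
      then show ?thesis by (simp add: power2_eq_square inverse_eq_divide)
    qed
  qed measurable
  then show ?thesis by simp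
qed

text \<open>
  A normalised bump function on the ball that generates the cones. The cone condition concerns single points
  \<open>x\<close> of the domain and is therefore a hypothesis of the individual lemmas.
\<close>

locale cone_mollifier =
  fixes \<Omega> :: "(real^2) set" and c :: "real^2" and s :: real and \<psi> :: "real^2 \<Rightarrow> real"
  assumes open_\<Omega>: "open \<Omega>" and bounded_\<Omega>: "bounded \<Omega>"
    and smooth: "smooth_fun \<psi>" and \<psi>_nonneg: "\<And>w. \<psi> w \<ge> 0"
    and \<psi>_support: "\<And>w. w \<notin> cball c s \<Longrightarrow> \<psi> w = 0"
    and \<psi>_integral: "(\<integral>\<^sup>+ w. ennreal (\<psi> w) \<partial>lborel) = 1"
begin

abbreviation "M \<equiv> lebesgue_on \<Omega>"

text \<open>
  The divergence of the vector field $w \mapsto \psi(w)\, w$ in the plane.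
\<close>

definition \<kappa> :: "real^2 \<Rightarrow> real" where
  "\<kappa> w = 2 * \<psi> w + frechet_derivative \<psi> (at w) w"

definition \<Psi> :: real where "\<Psi> = (SUP w\<in>cball c s. \<psi> w)"

definition R :: real where "R = norm c + \<bar>s\<bar>"

lemma \<Omega>_sets: "\<Omega> \<in> sets lebesgue"
  using open_\<Omega> by simp

lemma finite_measure_M: "finite_measure M"
  using bounded_\<Omega> \<Omega>_sets by (intro finite_measure_lebesgue_on bounded_set_imp_lmeasurable)

lemma Ck_fun_\<psi>: "Ck_fun k \<psi>" using smooth by (simp add: smooth_fun_def)

lemma \<psi>_has_derivative: "(\<psi> has_derivative frechet_derivative \<psi> (at w)) (at w)"
  using Ck_fun_\<psi>[of "Suc 0"] by (simp add: frechet_derivative_works)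

lemma continuous_\<psi>: "continuous_on S \<psi>"
  using Ck_fun_\<psi>[of 0] continuous_on_subset by auto

lemma \<psi>_le: "0 \<le> \<psi> w" "\<psi> w \<le> \<Psi>" "0 \<le> \<Psi>"
proof -
  have bdd: "bdd_above (\<psi> ` cball c s)"
    by (intro bounded_imp_bdd_above compact_imp_bounded compact_continuous_image continuous_\<psi> compact_cball)
  have le: "\<psi> w \<le> \<Psi>" if "w \<in> cball c s" for w
    unfolding \<Psi>_def using that bdd by (intro cSUP_upper)
  have "\<exists>w. \<psi> w \<noteq> 0"
  proof (rule ccontr)
    assume "\<nexists>w. \<psi> w \<noteq> 0"
    then show False using \<psi>_integral by simp
  qed
  then obtain w0 where "w0 \<in> cball c s" using \<psi>_support by blast
  then show "0 \<le> \<Psi>" using le[of w0] \<psi>_nonneg[of w0] by linarith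
  then show "\<psi> w \<le> \<Psi>" using le \<psi>_support[of w] by (cases "w \<in> cball c s") auto
qed (rule \<psi>_nonneg)

lemma \<psi>_norm_support: "\<psi> w \<noteq> 0 \<Longrightarrow> norm w \<le> R"
  using \<psi>_support[of w] norm_triangle_ineq[of "w - c" c]
  by (cases "w \<in> cball c s") (auto simp: R_def dist_norm norm_minus_commute)

lemma continuous_\<kappa>: "continuous_on UNIV \<kappa>"
proof -
  have "frechet_derivative \<psi> (at w) w = (\<Sum>b\<in>Basis. (w \<bullet> b) * frechet_derivative \<psi> (at w) b)" for w
  proof -
    have "linear (frechet_derivative \<psi> (at w))"
      using \<psi>_has_derivative has_derivative_linear by blast
    then have "frechet_derivative \<psi> (at w) (\<Sum>b\<in>Basis. (w \<bullet> b) *\<^sub>R b)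
        = (\<Sum>b\<in>Basis. (w \<bullet> b) * frechet_derivative \<psi> (at w) b)"
      by (simp add: linear_sum linear_cmul)
    then show ?thesis by (simp add: euclidean_representation)
  qed
  moreover have "continuous_on UNIV (\<lambda>w. frechet_derivative \<psi> (at w) b)" if "b \<in> Basis" for b
    using Ck_fun_\<psi>[of "Suc 0"] that by simp
  ultimately show ?thesis
    unfolding \<kappa>_def by (auto intro!: continuous_intros continuous_\<psi>)
qed

lemma measurable_\<psi>\<kappa> [measurable]: "\<psi> \<in> borel_measurable borel" "\<kappa> \<in> borel_measurable borel"
  using continuous_\<psi> continuous_\<kappa> by (auto intro: borel_measurable_continuous_onI)

text \<open>
  The components of the field $t^{-3} \psi((y-x)/t)\, (y-x)$ vanish outside $x + t B$, with $B$ the ball that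
  carries $\psi$; so the cone condition at $x$ is what makes them admissible test functions.
\<close>

lemma test_fun_cone_field:
  assumes t: "0 < t" "\<And>w. w \<in> cball c s \<Longrightarrow> x + t *\<^sub>R w \<in> \<Omega>"
  shows "test_fun \<Omega> (\<lambda>y. ((y - x) \<bullet> b) * ((1 / t ^ 3) * \<psi> ((1 / t) *\<^sub>R (y - x))))" (is "test_fun \<Omega> ?\<theta>")
proof -
  have "smooth_fun ?\<theta>" unfolding smooth_fun_def
    by (intro allI Ck_fun_mult Ck_fun_inner Ck_fun_const Ck_fun_affine Ck_fun_\<psi>)
  have cpt: "compact ((\<lambda>w. x + t *\<^sub>R w) ` cball c s)"
    by (intro compact_continuous_image continuous_intros compact_cball)
  have "{y. ?\<theta> y \<noteq> 0} \<subseteq> (\<lambda>w. x + t *\<^sub>R w) ` cball c s"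
  proof
    fix y assume "y \<in> {y. ?\<theta> y \<noteq> 0}"
    then have "\<psi> ((1 / t) *\<^sub>R (y - x)) \<noteq> 0" by auto
    then have "(1 / t) *\<^sub>R (y - x) \<in> cball c s" using \<psi>_support by blast
    moreover have "y = x + t *\<^sub>R ((1 / t) *\<^sub>R (y - x))" using t(1) by simp
    ultimately show "y \<in> (\<lambda>w. x + t *\<^sub>R w) ` cball c s" by blast
  qed
  then have sub: "closure {y. ?\<theta> y \<noteq> 0} \<subseteq> (\<lambda>w. x + t *\<^sub>R w) ` cball c s"
    using cpt by (intro closure_minimal compact_imp_closed)
  moreover have "(\<lambda>w. x + t *\<^sub>R w) ` cball c s \<subseteq> \<Omega>" using t(2) by blast
  moreover have "compact (closure {y. ?\<theta> y \<noteq> 0})"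
    using bounded_subset[OF compact_imp_bounded[OF cpt]] sub closure_subset by (subst compact_closure) blast
  ultimately show ?thesis using \<open>smooth_fun ?\<theta>\<close> unfolding test_fun_def by blast
qed

lemma frechet_derivative_cone_field:
  assumes t: "t \<noteq> 0"
  shows "frechet_derivative (\<lambda>y. ((y - x) \<bullet> b) * ((1 / t ^ 3) * \<psi> ((1 / t) *\<^sub>R (y - x)))) (at y) b
    = (1 / t ^ 3) * ((b \<bullet> b) * \<psi> ((1 / t) *\<^sub>R (y - x))
        + (((1 / t) *\<^sub>R (y - x)) \<bullet> b) * frechet_derivative \<psi> (at ((1 / t) *\<^sub>R (y - x))) b)"
proof -
  let ?D = "frechet_derivative \<psi> (at ((1 / t) *\<^sub>R (y - x)))"
  have lin: "linear ?D" using \<psi>_has_derivative has_derivative_linear by blast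
  have "((\<lambda>y. \<psi> ((1 / t) *\<^sub>R (y - x))) has_derivative (\<lambda>h. ?D ((1 / t) *\<^sub>R h))) (at y)"
    by (rule has_derivative_compose[of "\<lambda>y. (1 / t) *\<^sub>R (y - x)" _ y UNIV \<psi>, simplified, OF _ \<psi>_has_derivative])
       (auto intro!: derivative_eq_intros)
  then have "((\<lambda>y. ((y - x) \<bullet> b) * ((1 / t ^ 3) * \<psi> ((1 / t) *\<^sub>R (y - x)))) has_derivative
     (\<lambda>h. ((y - x) \<bullet> b) * ((1 / t ^ 3) * ?D ((1 / t) *\<^sub>R h)) + (h \<bullet> b) * ((1 / t ^ 3) * \<psi> ((1 / t) *\<^sub>R (y - x))))) (at y)"
    by (intro has_derivative_mult has_derivative_mult_right) (auto intro!: derivative_eq_intros)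
  note fd = frechet_derivative_at[OF this, symmetric]
  have D: "?D ((1 / t) *\<^sub>R b) = (1 / t) * ?D b" using linear_cmul[OF lin] by simp
  have alg: "A * (r * (u * d)) + B * (r * p) = r * (B * p + u * A * d)" for A r u d B p :: real
    by (simp add: algebra_simps)
  show ?thesis unfolding fd D inner_scaleR_left by (rule alg)
qed

lemma divergence_cone_field:
  assumes t: "t \<noteq> 0"
  shows "(\<Sum>b\<in>Basis. frechet_derivative (\<lambda>y. ((y - x) \<bullet> b) * ((1 / t ^ 3) * \<psi> ((1 / t) *\<^sub>R (y - x)))) (at y) b)
    = (1 / t ^ 3) * \<kappa> ((1 / t) *\<^sub>R (y - x))"
proof -
  define \<xi> where "\<xi> = (1 / t) *\<^sub>R (y - x)"
  let ?D = "frechet_derivative \<psi> (at \<xi>)"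
  have lin: "linear ?D" using \<psi>_has_derivative has_derivative_linear by blast
  have "(\<Sum>b\<in>Basis. frechet_derivative (\<lambda>y. ((y - x) \<bullet> b) * ((1 / t ^ 3) * \<psi> ((1 / t) *\<^sub>R (y - x)))) (at y) b)
      = (1 / t ^ 3) * ((\<Sum>b\<in>(Basis::(real^2) set). \<psi> \<xi>) + (\<Sum>b\<in>Basis. (\<xi> \<bullet> b) * ?D b))"
  proof -
    have "(\<Sum>b\<in>Basis. (1 / t ^ 3) * ((b \<bullet> b) * \<psi> \<xi> + (\<xi> \<bullet> b) * ?D b))
        = (\<Sum>b\<in>Basis. (1 / t ^ 3) * (\<psi> \<xi> + (\<xi> \<bullet> b) * ?D b))"
      by (intro sum.cong refl) (simp add: inner_same_Basis)
    then show ?thesis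
      unfolding frechet_derivative_cone_field[OF t] \<xi>_def[symmetric]
      by (simp only: sum_distrib_left[symmetric] sum.distrib)
  qed
  also have "(\<Sum>b\<in>Basis. (\<xi> \<bullet> b) * ?D b) = ?D (\<Sum>b\<in>Basis. (\<xi> \<bullet> b) *\<^sub>R b)"
    using lin by (simp add: linear_sum linear_cmul)
  also have "\<dots> = ?D \<xi>" by (simp only: euclidean_representation)
  finally show ?thesis by (simp add: \<kappa>_def \<xi>_def)
qed

text \<open>
  Together with the divergence computed above this says that, for the dilated bump
  $\varphi_t(z) = t^{-2} \psi(z/t)$, the derivative in the scale $t$ is minus the divergence of the cone field.
\<close>

lemma dilation_has_derivative:
  assumes t: "t > 0"
  shows "((\<lambda>t. (1 / t\<^sup>2) * \<psi> ((1 / t) *\<^sub>R z)) has_real_derivative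
      - ((1 / t ^ 3) * \<kappa> ((1 / t) *\<^sub>R z))) (at t)"
proof -
  let ?D = "frechet_derivative \<psi> (at ((1 / t) *\<^sub>R z))"
  have lin: "linear ?D" using \<psi>_has_derivative has_derivative_linear by blast
  have "((\<lambda>t. (1 / t) *\<^sub>R z) has_derivative (\<lambda>h. (- (h / t\<^sup>2)) *\<^sub>R z)) (at t)"
    using t by (auto intro!: derivative_eq_intros simp: power2_eq_square)
  then have "((\<lambda>t. \<psi> ((1 / t) *\<^sub>R z)) has_derivative (\<lambda>h. ?D ((- (h / t\<^sup>2)) *\<^sub>R z))) (at t)"
    by (rule has_derivative_compose[of "\<lambda>t. (1 / t) *\<^sub>R z" _ t UNIV \<psi>, simplified, OF _ \<psi>_has_derivative])
  moreover have "(\<lambda>h. ?D ((- (h / t\<^sup>2)) *\<^sub>R z)) = (*) (- (1 / t) * ?D ((1 / t) *\<^sub>R z))"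
    using t by (intro ext, simp only: linear_cmul[OF lin]) (simp add: power2_eq_square)
  ultimately have "((\<lambda>t. \<psi> ((1 / t) *\<^sub>R z)) has_real_derivative - (1 / t) * ?D ((1 / t) *\<^sub>R z)) (at t)"
    unfolding has_field_derivative_def by simp
  then have "((\<lambda>t. (1 / t\<^sup>2) * \<psi> ((1 / t) *\<^sub>R z)) has_real_derivative
      (1 / t\<^sup>2) * (- (1 / t) * ?D ((1 / t) *\<^sub>R z)) + (- (2 / t ^ 3)) * \<psi> ((1 / t) *\<^sub>R z)) (at t)"
    using t by (auto intro!: derivative_eq_intros simp: power2_eq_square power3_eq_cube field_simps)
  moreover have "(1 / t\<^sup>2) * (- (1 / t) * ?D ((1 / t) *\<^sub>R z)) + (- (2 / t ^ 3)) * \<psi> ((1 / t) *\<^sub>R z)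
     = - ((1 / t ^ 3) * \<kappa> ((1 / t) *\<^sub>R z))"
    using t by (simp add: \<kappa>_def power2_eq_square power3_eq_cube field_simps)
  ultimately show ?thesis by simp
qed

lemma fst_snd_borel_M [measurable]:
  "(\<lambda>x. x) \<in> borel_measurable M" "fst \<in> borel_measurable (M \<Otimes>\<^sub>M N)" "snd \<in> borel_measurable (N \<Otimes>\<^sub>M M)"
  by (rule fst_snd_borel_lebesgue_on)+

lemma R_nonneg: "0 \<le> R" by (simp add: R_def)

lemma integrable_times_continuous:
  fixes f g :: "real^2 \<Rightarrow> real"
  assumes f: "integrable M f" and g: "continuous_on UNIV g"
  shows "integrable M (\<lambda>y. f y * g y)"
proof -
  have [measurable]: "g \<in> borel_measurable borel" "f \<in> borel_measurable M"
    using f g by (auto intro: borel_measurable_continuous_onI)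
  have "compact (g ` closure \<Omega>)"
    using bounded_\<Omega> g by (intro compact_continuous_image) (auto intro: continuous_on_subset)
  then obtain C where C: "\<forall>r\<in>g ` closure \<Omega>. norm r \<le> C"
    using compact_imp_bounded bounded_iff by blast
  show ?thesis
  proof (rule Bochner_Integration.integrable_bound[of M "\<lambda>y. f y * C"])
    show "AE y in M. norm (f y * g y) \<le> norm (f y * C)"
    proof (rule AE_I2)
      fix y assume "y \<in> space M"
      then have "norm (g y) \<le> C" using C closure_subset[of \<Omega>] by auto
      then show "norm (f y * g y) \<le> norm (f y * C)"
        unfolding norm_mult by (intro mult_left_mono) auto
    qed
  qed (use f in \<open>auto\<close>)
qed

text \<open>
  The definition of the weak derivative enters here: the defining identity is applied to each component of
  the cone field, and the sum over the components is the divergence on the left-hand side.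
\<close>

lemma averaged_gradient_identity:
  assumes wp: "\<And>b. b \<in> Basis \<Longrightarrow> weak_partial \<Omega> b f (h b)"
    and f: "integrable M f" and h: "\<And>b. b \<in> Basis \<Longrightarrow> integrable M (h b)"
    and t: "0 < t" "\<And>w. w \<in> cball c s \<Longrightarrow> x + t *\<^sub>R w \<in> \<Omega>"
  shows "(LINT y|M. f y * ((1 / t ^ 3) * \<kappa> ((1 / t) *\<^sub>R (y - x))))
    = - (LINT y|M. (\<Sum>b\<in>Basis. h b y * (((y - x) \<bullet> b) * ((1 / t ^ 3) * \<psi> ((1 / t) *\<^sub>R (y - x))))))"
proof -
  let ?\<theta> = "\<lambda>b y. ((y - x) \<bullet> b) * ((1 / t ^ 3) * \<psi> ((1 / t) *\<^sub>R (y - x)))"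
  have Ck: "Ck_fun k (?\<theta> b)" for b k
    by (intro Ck_fun_mult Ck_fun_inner Ck_fun_const Ck_fun_affine Ck_fun_\<psi>)
  have int1: "integrable M (\<lambda>y. f y * frechet_derivative (?\<theta> b) (at y) b)" if "b \<in> Basis" for b
    using Ck[of "Suc 0" b] that by (intro integrable_times_continuous f) simp
  have int2: "integrable M (\<lambda>y. h b y * ?\<theta> b y)" if "b \<in> Basis" for b
    using Ck[of 0 b] that by (intro integrable_times_continuous h) simp_all
  have "(LINT y|M. f y * ((1 / t ^ 3) * \<kappa> ((1 / t) *\<^sub>R (y - x))))
      = (LINT y|M. (\<Sum>b\<in>Basis. f y * frechet_derivative (?\<theta> b) (at y) b))"
    using t(1) by (intro Bochner_Integration.integral_cong refl)
      (simp only: divergence_cone_field[OF less_imp_neq[OF t(1), symmetric], symmetric] sum_distrib_left)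
  also have "\<dots> = (\<Sum>b\<in>Basis. LINT y|M. f y * frechet_derivative (?\<theta> b) (at y) b)"
    using int1 by (rule Bochner_Integration.integral_sum)
  also have "\<dots> = (\<Sum>b\<in>Basis. - (LINT y|M. h b y * ?\<theta> b y))"
    using wp test_fun_cone_field[OF t] unfolding weak_partial_def by (intro sum.cong refl) blast
  also have "\<dots> = - (LINT y|M. (\<Sum>b\<in>Basis. h b y * ?\<theta> b y))"
    using int2 by (simp add: Bochner_Integration.integral_sum sum_negf)
  finally show ?thesis .
qed

text \<open>
  The bump at scale $t$ vanishes beyond the distance $R t$, which the indicator records. The dependence on $t$
  is confined to the last factor, over which the scales are integrated next.
\<close>

lemma averaged_gradient_bound:
  assumes wp: "\<And>b. b \<in> Basis \<Longrightarrow> weak_partial \<Omega> b f (h b)"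
    and f: "integrable M f" and h: "\<And>b. b \<in> Basis \<Longrightarrow> integrable M (h b)"
    and t: "0 < t" "\<And>w. w \<in> cball c s \<Longrightarrow> x + t *\<^sub>R w \<in> \<Omega>"
  shows "ennreal \<bar>LINT y|M. f y * ((1 / t ^ 3) * \<kappa> ((1 / t) *\<^sub>R (y - x)))\<bar>
    \<le> (\<integral>\<^sup>+ y. ennreal ((\<Sum>b\<in>Basis. \<bar>h b y\<bar>) * norm (y - x) * \<Psi>)
          * (ennreal (1 / t ^ 3) * indicator {norm (y - x)..} (R * t)) \<partial>M)"
proof -
  let ?\<theta> = "\<lambda>b y. ((y - x) \<bullet> b) * ((1 / t ^ 3) * \<psi> ((1 / t) *\<^sub>R (y - x)))"
  have "Ck_fun 0 (?\<theta> b)" for b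
    by (intro Ck_fun_mult Ck_fun_inner Ck_fun_const Ck_fun_affine Ck_fun_\<psi>)
  then have int2: "integrable M (\<lambda>y. h b y * ?\<theta> b y)" if "b \<in> Basis" for b
    using that by (intro integrable_times_continuous h) simp_all
  have "ennreal \<bar>LINT y|M. f y * ((1 / t ^ 3) * \<kappa> ((1 / t) *\<^sub>R (y - x)))\<bar>
      = ennreal (norm (LINT y|M. (\<Sum>b\<in>Basis. h b y * ?\<theta> b y)))"
    by (subst averaged_gradient_identity[OF wp f h t]) simp_all
  also have "\<dots> \<le> (\<integral>\<^sup>+ y. norm (\<Sum>b\<in>Basis. h b y * ?\<theta> b y) \<partial>M)"
    using int2 by (intro integral_norm_bound_ennreal Bochner_Integration.integrable_sum)
  also have "\<dots> \<le> (\<integral>\<^sup>+ y. ennreal ((\<Sum>b\<in>Basis. \<bar>h b y\<bar>) * norm (y - x) * \<Psi>)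
          * (ennreal (1 / t ^ 3) * indicator {norm (y - x)..} (R * t)) \<partial>M)"
  proof (rule nn_integral_mono)
    fix y
    let ?G = "\<Sum>b\<in>Basis. \<bar>h b y\<bar>"
    have "norm (\<Sum>b\<in>Basis. h b y * ?\<theta> b y) \<le> (\<Sum>b\<in>Basis. \<bar>h b y * ?\<theta> b y\<bar>)"
      unfolding real_norm_def by (rule sum_abs)
    also have "\<dots> \<le> (\<Sum>b\<in>Basis. \<bar>h b y\<bar> * (norm (y - x) * ((1 / t ^ 3) * \<psi> ((1 / t) *\<^sub>R (y - x)))))"
    proof (intro sum_mono)
      fix b :: "real^2" assume b: "b \<in> Basis"
      have "\<bar>?\<theta> b y\<bar> \<le> norm (y - x) * ((1 / t ^ 3) * \<psi> ((1 / t) *\<^sub>R (y - x)))"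
        unfolding abs_mult using t(1) \<psi>_le Basis_le_norm[OF b]
        by (intro mult_mono) auto
      then show "\<bar>h b y * ?\<theta> b y\<bar> \<le> \<bar>h b y\<bar> * (norm (y - x) * ((1 / t ^ 3) * \<psi> ((1 / t) *\<^sub>R (y - x))))"
        unfolding abs_mult[of "h b y"] by (intro mult_left_mono) auto
    qed
    also have "\<dots> = ?G * norm (y - x) * (1 / t ^ 3) * \<psi> ((1 / t) *\<^sub>R (y - x))"
      by (simp only: sum_distrib_right mult.assoc)
    also have "\<dots> \<le> ?G * norm (y - x) * (1 / t ^ 3) * (\<Psi> * indicator {norm (y - x)..} (R * t))"
    proof (intro mult_left_mono)
      show "\<psi> ((1 / t) *\<^sub>R (y - x)) \<le> \<Psi> * indicator {norm (y - x)..} (R * t)"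
      proof (cases "\<psi> ((1 / t) *\<^sub>R (y - x)) = 0")
        case False
        then have "norm (y - x) \<le> R * t"
          using \<psi>_norm_support[of "(1 / t) *\<^sub>R (y - x)"] t(1)
          unfolding norm_scaleR by (simp add: divide_le_eq)
        then show ?thesis using \<psi>_le by simp
      qed (use \<psi>_le in simp)
      show "0 \<le> ?G * norm (y - x) * (1 / t ^ 3)"
        using t(1) by (intro mult_nonneg_nonneg sum_nonneg) auto
    qed
    also have "\<dots> = (?G * norm (y - x) * \<Psi>) * (1 / t ^ 3) * indicator {norm (y - x)..} (R * t)"
      by simp
    finally have "norm (\<Sum>b\<in>Basis. h b y * ?\<theta> b y) \<le> \<dots>" .
    then have "ennreal (norm (\<Sum>b\<in>Basis. h b y * ?\<theta> b y))
       \<le> ennreal ((?G * norm (y - x) * \<Psi>) * (1 / t ^ 3) * indicator {norm (y - x)..} (R * t))"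
      by (rule ennreal_leI)
    also have "\<dots> = ennreal (?G * norm (y - x) * \<Psi>) * (ennreal (1 / t ^ 3) * indicator {norm (y - x)..} (R * t))"
    proof -
      have "ennreal (a * r * indicator S u) = ennreal a * (ennreal r * indicator S u)"
        if "0 \<le> a" for a r u :: real and S
        using that by (simp add: indicator_def ennreal_mult')
      moreover have "0 \<le> ?G * norm (y - x) * \<Psi>"
        using \<psi>_le(3) by (intro mult_nonneg_nonneg sum_nonneg) auto
      ultimately show ?thesis by blast
    qed
    finally show "ennreal (norm (\<Sum>b\<in>Basis. h b y * ?\<theta> b y))
      \<le> ennreal (?G * norm (y - x) * \<Psi>) * (ennreal (1 / t ^ 3) * indicator {norm (y - x)..} (R * t))" .
  qed
  finally show ?thesis .
qed

lemma scale_integral_bound: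
  assumes "0 \<le> G"
  shows "(\<integral>\<^sup>+ t. ennreal (G * norm z * \<Psi>) * (ennreal (1 / t ^ 3) * indicator {norm z..} (R * t))
            * indicator {\<epsilon>..1} t \<partial>lborel) \<le> ennreal (\<Psi> * R\<^sup>2 / 2 * (G / norm (z::real^2)))"
    (is "?lhs \<le> _")
proof (cases "norm z = 0 \<or> R = 0")
  case True
  then have "?lhs = (\<integral>\<^sup>+ t. 0 \<partial>(lborel :: real measure))"
    by (intro nn_integral_cong) (auto simp: indicator_def)
  then show ?thesis by simp
next
  case False
  then have pos: "norm z > 0" "R > 0" using R_nonneg by auto
  define r where "r = norm z / R"
  have r: "r > 0" using pos by (simp add: r_def)
  have a: "0 \<le> G * norm z * \<Psi>" using assms \<psi>_le by simp
  have "?lhs \<le> (\<integral>\<^sup>+ t. ennreal (G * norm z * \<Psi>) * (ennreal (1 / t ^ 3) * indicator {r..} t) \<partial>lborel)"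
    using pos by (intro nn_integral_mono) (auto simp: indicator_def r_def field_simps)
  also have "\<dots> = ennreal (G * norm z * \<Psi>) * ennreal (1 / (2 * r\<^sup>2))"
    by (simp add: nn_integral_cmult nn_integral_cube_tail[OF r])
  also have "\<dots> = ennreal (G * norm z * \<Psi> * (1 / (2 * r\<^sup>2)))"
    by (rule ennreal_mult[OF a, symmetric]) simp
  also have "G * norm z * \<Psi> * (1 / (2 * r\<^sup>2)) = \<Psi> * R\<^sup>2 / 2 * (G / norm z)"
    using pos by (simp add: r_def power2_eq_square field_simps)
  finally show ?thesis .
qed

lemma bounded_dilation_kernel:
  assumes "x \<in> \<Omega>" "0 < \<epsilon>"
  obtains C where "\<And>t y. t \<in> {\<epsilon>..1} \<Longrightarrow> y \<in> \<Omega> \<Longrightarrow> \<bar>(1 / t ^ 3) * \<kappa> ((1 / t) *\<^sub>R (y - x))\<bar> \<le> C"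
proof -
  obtain D where D: "\<forall>x\<in>\<Omega>. \<forall>y\<in>\<Omega>. dist x y \<le> D"
    using bounded_\<Omega> unfolding bounded_two_points by (rule exE)
  have "compact (\<kappa> ` cball 0 (D / \<epsilon>))"
    using continuous_\<kappa> by (intro compact_continuous_image) (auto intro: continuous_on_subset)
  then obtain B where B: "\<forall>r\<in>\<kappa> ` cball 0 (D / \<epsilon>). norm r \<le> B"
    using compact_imp_bounded bounded_iff by blast
  have "\<bar>(1 / t ^ 3) * \<kappa> ((1 / t) *\<^sub>R (y - x))\<bar> \<le> (1 / \<epsilon> ^ 3) * B" if "t \<in> {\<epsilon>..1}" "y \<in> \<Omega>" for t y
  proof -
    have t: "0 < t" "\<epsilon> \<le> t" using that assms(2) by auto
    have "norm (y - x) \<le> D" using D assms(1) that(2) by (metis dist_norm)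
    moreover from this have "0 \<le> D" using norm_ge_zero order_trans by blast
    ultimately have "norm ((1 / t) *\<^sub>R (y - x)) \<le> D / \<epsilon>"
      using t assms(2) by (simp add: frac_le)
    then have "norm (\<kappa> ((1 / t) *\<^sub>R (y - x))) \<le> B" using B by simp
    moreover have "\<bar>1 / t ^ 3\<bar> \<le> 1 / \<epsilon> ^ 3"
      using t assms(2) by (simp add: frac_le power_mono)
    ultimately show ?thesis
      unfolding abs_mult real_norm_def using assms(2) by (intro mult_mono) auto
  qed
  then show ?thesis by (rule that)
qed

text \<open>
  The difference of the averages at scales $\epsilon$ and 1 is the integral of the scale derivative. After
  exchanging the integrals over $y$ and over $t$, the weak derivatives turn $f$ into the gradient, and
  exchanging them back collects all scales at a fixed $y$ into the kernel $1/|x-y|$.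
\<close>

lemma average_difference_bound:
  assumes wp: "\<And>b. b \<in> Basis \<Longrightarrow> weak_partial \<Omega> b f (h b)"
    and f: "integrable M f" and h: "\<And>b. b \<in> Basis \<Longrightarrow> integrable M (h b)"
    and \<epsilon>: "0 < \<epsilon>" "\<epsilon> \<le> 1"
    and x: "x \<in> \<Omega>" and cone: "\<And>t w. 0 < t \<Longrightarrow> t \<le> 1 \<Longrightarrow> w \<in> cball c s \<Longrightarrow> x + t *\<^sub>R w \<in> \<Omega>"
  shows "ennreal \<bar>(LINT y|M. f y * ((1 / \<epsilon>\<^sup>2) * \<psi> ((1 / \<epsilon>) *\<^sub>R (y - x)))) - (LINT y|M. f y * \<psi> (y - x))\<bar>
    \<le> (\<integral>\<^sup>+ y. ennreal (\<Psi> * R\<^sup>2 / 2 * ((\<Sum>b\<in>Basis. \<bar>h b y\<bar>) / norm (y - x))) \<partial>M)"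
proof -
  interpret M: finite_measure M by (rule finite_measure_M)
  interpret P: pair_sigma_finite M "lborel :: real measure" ..
  have [measurable]: "f \<in> borel_measurable M" using f by simp
  have hm [measurable]: "b \<in> Basis \<Longrightarrow> h b \<in> borel_measurable M" for b using h by simp
  let ?k = "\<lambda>y t. (1 / t ^ 3) * \<kappa> ((1 / t) *\<^sub>R (y - x)) * indicator {\<epsilon>..1} t"
  obtain C where C: "\<And>t y. t \<in> {\<epsilon>..1} \<Longrightarrow> y \<in> \<Omega> \<Longrightarrow> \<bar>(1 / t ^ 3) * \<kappa> ((1 / t) *\<^sub>R (y - x))\<bar> \<le> C"
    using bounded_dilation_kernel[OF x \<epsilon>(1)] by blast
  have int: "integrable (M \<Otimes>\<^sub>M lborel) (\<lambda>(y, t). f y * ?k y t)"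
  proof (rule P.integrable_times_bounded_kernel[OF f, where C = C and A = "{\<epsilon>..1}"])
    show "(\<lambda>(y, t). ?k y t) \<in> borel_measurable (M \<Otimes>\<^sub>M lborel)" by measurable
    show "\<bar>?k y t\<bar> \<le> C * indicator {\<epsilon>..1} t" if "y \<in> space M" for y t
      using C[of t y] that by (auto simp: indicator_def)
  qed (auto simp: emeasure_lborel_Icc_eq)
  have FTC: "(LBINT t. ?k y t) = (1 / \<epsilon>\<^sup>2) * \<psi> ((1 / \<epsilon>) *\<^sub>R (y - x)) - \<psi> (y - x)" for y
  proof -
    have "(LBINT t. ?k y t) = - ((1 / 1\<^sup>2) * \<psi> ((1 / 1) *\<^sub>R (y - x))) - - ((1 / \<epsilon>\<^sup>2) * \<psi> ((1 / \<epsilon>) *\<^sub>R (y - x)))"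
    proof (rule integral_FTC_Icc_real)
      fix t assume t: "\<epsilon> \<le> t" "t \<le> 1"
      then have "t > 0" using \<epsilon> by simp
      then show "((\<lambda>t. - ((1 / t\<^sup>2) * \<psi> ((1 / t) *\<^sub>R (y - x)))) has_real_derivative
          (1 / t ^ 3) * \<kappa> ((1 / t) *\<^sub>R (y - x))) (at t)"
        using DERIV_minus[OF dilation_has_derivative] by fastforce
      have "isCont (\<lambda>t. (1 / t) *\<^sub>R (y - x)) t"
        using \<open>t > 0\<close> by (intro continuous_intros) simp
      moreover have "isCont \<kappa> ((1 / t) *\<^sub>R (y - x))"
        using continuous_\<kappa> by (simp add: continuous_on_eq_continuous_at)
      ultimately have "isCont (\<lambda>t. \<kappa> ((1 / t) *\<^sub>R (y - x))) t" by (rule isCont_o2)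
      then show "isCont (\<lambda>t. (1 / t ^ 3) * \<kappa> ((1 / t) *\<^sub>R (y - x))) t"
        using \<open>t > 0\<close> by (intro continuous_mult) (auto intro!: continuous_intros)
    qed (use \<epsilon> in auto)
    then show ?thesis by simp
  qed
  have ints: "integrable M (\<lambda>y. f y * ((1 / r\<^sup>2) * \<psi> ((1 / r) *\<^sub>R (y - x))))" for r
    by (intro integrable_times_continuous f continuous_intros continuous_on_compose2[OF continuous_\<psi>[of UNIV]]) auto
  have "(LINT y|M. f y * ((1 / \<epsilon>\<^sup>2) * \<psi> ((1 / \<epsilon>) *\<^sub>R (y - x)))) - (LINT y|M. f y * \<psi> (y - x))
      = (LINT y|M. f y * (LBINT t. ?k y t))"
    unfolding FTC right_diff_distrib
    using ints[of 1] by (intro Bochner_Integration.integral_diff[symmetric] ints) simp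
  also have "\<dots> = (LINT y|M. (LBINT t. f y * ?k y t))"
    by (simp only: integral_mult_right_zero)
  also have "\<dots> = (LBINT t. (LINT y|M. f y * ?k y t))"
    by (rule P.Fubini_integral[OF int, symmetric])
  finally have eq: "(LINT y|M. f y * ((1 / \<epsilon>\<^sup>2) * \<psi> ((1 / \<epsilon>) *\<^sub>R (y - x)))) - (LINT y|M. f y * \<psi> (y - x))
      = (LBINT t. (LINT y|M. f y * ?k y t))" .
  have "ennreal \<bar>LBINT t. (LINT y|M. f y * ?k y t)\<bar> \<le> (\<integral>\<^sup>+ t. norm (LINT y|M. f y * ?k y t) \<partial>lborel)"
    using integral_norm_bound_ennreal[OF P.integrable_snd[OF int]] by simp
  also have "\<dots> \<le> (\<integral>\<^sup>+ t. (\<integral>\<^sup>+ y. ennreal ((\<Sum>b\<in>Basis. \<bar>h b y\<bar>) * norm (y - x) * \<Psi>)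
          * (ennreal (1 / t ^ 3) * indicator {norm (y - x)..} (R * t)) * indicator {\<epsilon>..1} t \<partial>M) \<partial>lborel)"
  proof (rule nn_integral_mono)
    fix t :: real
    show "ennreal (norm (LINT y|M. f y * ?k y t)) \<le> (\<integral>\<^sup>+ y. ennreal ((\<Sum>b\<in>Basis. \<bar>h b y\<bar>) * norm (y - x) * \<Psi>)
          * (ennreal (1 / t ^ 3) * indicator {norm (y - x)..} (R * t)) * indicator {\<epsilon>..1} t \<partial>M)"
    proof (cases "t \<in> {\<epsilon>..1}")
      case True
      then show ?thesis
        using averaged_gradient_bound[OF wp f h, of t x] cone[of t] \<epsilon> by simp
    qed simp
  qed
  also have "\<dots> = (\<integral>\<^sup>+ y. (\<integral>\<^sup>+ t. ennreal ((\<Sum>b\<in>Basis. \<bar>h b y\<bar>) * norm (y - x) * \<Psi>)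
          * (ennreal (1 / t ^ 3) * indicator {norm (y - x)..} (R * t)) * indicator {\<epsilon>..1} t \<partial>lborel) \<partial>M)"
    unfolding indicator_def of_bool_def atLeast_iff atLeastAtMost_iff by (rule P.Fubini') measurable
  also have "\<dots> \<le> (\<integral>\<^sup>+ y. ennreal (\<Psi> * R\<^sup>2 / 2 * ((\<Sum>b\<in>Basis. \<bar>h b y\<bar>) / norm (y - x))) \<partial>M)"
    by (intro nn_integral_mono scale_integral_bound sum_nonneg) auto
  finally show ?thesis unfolding eq .
qed

text \<open>
  At scale 1 the bump is bounded by \<open>\<Psi>\<close>, so the average there is at most a multiple of the integral of $|f|$; passing to
  smaller scales costs the potential of the gradient. The bound is uniform in \<open>\<epsilon>\<close>.
\<close>

lemma average_bound:
  assumes wp: "\<And>b. b \<in> Basis \<Longrightarrow> weak_partial \<Omega> b f (h b)"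
    and f: "integrable M f" and h: "\<And>b. b \<in> Basis \<Longrightarrow> integrable M (h b)"
    and \<epsilon>: "0 < \<epsilon>" "\<epsilon> \<le> 1"
    and x: "x \<in> \<Omega>" and cone: "\<And>t w. 0 < t \<Longrightarrow> t \<le> 1 \<Longrightarrow> w \<in> cball c s \<Longrightarrow> x + t *\<^sub>R w \<in> \<Omega>"
  shows "ennreal \<bar>LINT y|M. f y * ((1 / \<epsilon>\<^sup>2) * \<psi> ((1 / \<epsilon>) *\<^sub>R (y - x)))\<bar>
    \<le> ennreal (\<Psi> * (1 + R\<^sup>2)) * ((\<integral>\<^sup>+ y. ennreal \<bar>f y\<bar> \<partial>M)
          + (\<integral>\<^sup>+ y. ennreal ((\<Sum>b\<in>Basis. \<bar>h b y\<bar>) / norm (x - y)) \<partial>M))"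
proof -
  have [measurable]: "f \<in> borel_measurable M" using f by simp
  have hm [measurable]: "b \<in> Basis \<Longrightarrow> h b \<in> borel_measurable M" for b using h by simp
  let ?C = "\<Psi> * (1 + R\<^sup>2)"
  let ?A = "LINT y|M. f y * ((1 / \<epsilon>\<^sup>2) * \<psi> ((1 / \<epsilon>) *\<^sub>R (y - x)))"
  let ?A1 = "LINT y|M. f y * \<psi> (y - x)"
  have C: "\<Psi> \<le> ?C" "\<Psi> * R\<^sup>2 / 2 \<le> ?C" "0 \<le> ?C"
    using \<psi>_le(3) by (auto simp: distrib_left)
  have "integrable M (\<lambda>y. f y * \<psi> (y - x))"
    by (intro integrable_times_continuous f continuous_intros continuous_on_compose2[OF continuous_\<psi>[of UNIV]]) auto
  then have "ennreal \<bar>?A1\<bar> \<le> (\<integral>\<^sup>+ y. ennreal (norm (f y * \<psi> (y - x))) \<partial>M)"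
    using integral_norm_bound_ennreal[of M "\<lambda>y. f y * \<psi> (y - x)"] by simp
  also have "\<dots> \<le> (\<integral>\<^sup>+ y. ennreal ?C * ennreal \<bar>f y\<bar> \<partial>M)"
  proof (rule nn_integral_mono)
    fix y
    have "norm (f y * \<psi> (y - x)) \<le> ?C * \<bar>f y\<bar>"
      using mult_right_mono[OF order_trans[OF \<psi>_le(2)[of "y - x"] C(1)], of "\<bar>f y\<bar>"] \<psi>_le(1)
      by (simp add: abs_mult mult.commute)
    then show "ennreal (norm (f y * \<psi> (y - x))) \<le> ennreal ?C * ennreal \<bar>f y\<bar>"
      using C(3) by (simp add: ennreal_mult[symmetric] ennreal_leI)
  qed
  also have "\<dots> = ennreal ?C * (\<integral>\<^sup>+ y. ennreal \<bar>f y\<bar> \<partial>M)" by (rule nn_integral_cmult) measurable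
  finally have 1: "ennreal \<bar>?A1\<bar> \<le> ennreal ?C * (\<integral>\<^sup>+ y. ennreal \<bar>f y\<bar> \<partial>M)" .
  have "ennreal \<bar>?A - ?A1\<bar> \<le> (\<integral>\<^sup>+ y. ennreal (\<Psi> * R\<^sup>2 / 2 * ((\<Sum>b\<in>Basis. \<bar>h b y\<bar>) / norm (y - x))) \<partial>M)"
    by (rule average_difference_bound[OF wp f h \<epsilon> x cone])
  also have "\<dots> \<le> (\<integral>\<^sup>+ y. ennreal ?C * ennreal ((\<Sum>b\<in>Basis. \<bar>h b y\<bar>) / norm (x - y)) \<partial>M)"
  proof (rule nn_integral_mono)
    fix y
    have G: "0 \<le> (\<Sum>b\<in>Basis. \<bar>h b y\<bar>) / norm (y - x)" by (simp add: sum_nonneg)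
    show "ennreal (\<Psi> * R\<^sup>2 / 2 * ((\<Sum>b\<in>Basis. \<bar>h b y\<bar>) / norm (y - x)))
        \<le> ennreal ?C * ennreal ((\<Sum>b\<in>Basis. \<bar>h b y\<bar>) / norm (x - y))"
      unfolding ennreal_mult[OF C(3) G, unfolded norm_minus_commute[of y x], symmetric] norm_minus_commute[of y x]
      using mult_right_mono[OF C(2) G] by (intro ennreal_leI) (simp add: norm_minus_commute)
  qed
  also have "\<dots> = ennreal ?C * (\<integral>\<^sup>+ y. ennreal ((\<Sum>b\<in>Basis. \<bar>h b y\<bar>) / norm (x - y)) \<partial>M)"
    by (rule nn_integral_cmult) measurable
  finally have 2: "ennreal \<bar>?A - ?A1\<bar> \<le> \<dots>" .
  have "ennreal \<bar>?A\<bar> \<le> ennreal (\<bar>?A1\<bar> + \<bar>?A - ?A1\<bar>)" by (intro ennreal_leI) linarith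
  also have "\<dots> = ennreal \<bar>?A1\<bar> + ennreal \<bar>?A - ?A1\<bar>" by simp
  also have "\<dots> \<le> ennreal ?C * (\<integral>\<^sup>+ y. ennreal \<bar>f y\<bar> \<partial>M)
      + ennreal ?C * (\<integral>\<^sup>+ y. ennreal ((\<Sum>b\<in>Basis. \<bar>h b y\<bar>) / norm (x - y)) \<partial>M)"
    by (intro add_mono 1 2)
  finally show ?thesis by (simp only: distrib_left)
qed

end

section \<open>From averages to a pointwise bound\<close>

text \<open>
  Lebesgue's differentiation theorem along shrinking boxes: the value of \<open>w\<close> at almost every
  point is the limit of the averages over boxes with a corner at that point.
\<close>

lemma AE_nonneg_of_box_integrals:
  fixes w :: "'a::euclidean_space \<Rightarrow> real"
  assumes \<Omega>: "\<Omega> \<in> sets lebesgue" and w: "integrable (lebesgue_on \<Omega>) w"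
    and U: "open U" "U \<subseteq> \<Omega>"
    and box: "\<And>a b. cbox a b \<subseteq> U \<Longrightarrow> 0 \<le> (LINT y|lebesgue_on \<Omega>. indicator (cbox a b) y * w y)"
  shows "AE x in lebesgue_on \<Omega>. x \<in> U \<longrightarrow> 0 \<le> w x"
proof -
  define w' where "w' x = indicator \<Omega> x *\<^sub>R w x" for x
  have int: "integrable lebesgue w'"
    using w \<Omega> unfolding w'_def by (simp add: integrable_restrict_space)
  have set_int: "set_integrable lebesgue (cbox a b) w'" for a b
    unfolding set_integrable_def using int by (intro integrable_mult_indicator) auto
  have eq: "integral (cbox a b) w' = (LINT y|lebesgue_on \<Omega>. indicator (cbox a b) y * w y)" for a b
  proof -
    have "(LINT y|lebesgue_on \<Omega>. indicator (cbox a b) y * w y)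
        = (LINT y|lebesgue. indicator \<Omega> y *\<^sub>R (indicator (cbox a b) y * w y))"
      using \<Omega> by (intro integral_restrict_space) auto
    also have "\<dots> = (LINT y:cbox a b|lebesgue. w' y)"
      unfolding set_lebesgue_integral_def w'_def by (intro Bochner_Integration.integral_cong) auto
    also have "\<dots> = integral (cbox a b) w'" by (rule set_lebesgue_integral_eq_integral(2)[OF set_int])
    finally show ?thesis ..
  qed
  obtain N where N: "negligible N" and diff: "\<And>x e. \<lbrakk>x \<notin> N; 0 < e\<rbrakk> \<Longrightarrow> \<exists>d>0. \<forall>h. 0 < h \<and> h < d \<longrightarrow>
      norm (integral (cbox x (x + h *\<^sub>R One)) w' /\<^sub>R h ^ DIM('a) - w' x) < e"
    by (rule integrable_ccontinuous_explicit[of w'])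
       (use set_lebesgue_integral_eq_integral(1)[OF set_int] in blast)+
  have pt: "0 \<le> w x" if x: "x \<in> U" "x \<notin> N" for x
  proof (rule ccontr)
    assume neg: "\<not> 0 \<le> w x"
    have w'x: "w' x = w x" using x U by (auto simp: w'_def)
    obtain d where d: "d > 0" "\<forall>h. 0 < h \<and> h < d \<longrightarrow>
        norm (integral (cbox x (x + h *\<^sub>R One)) w' /\<^sub>R h ^ DIM('a) - w' x) < - w x"
      using diff[OF x(2), of "- w x"] neg by auto
    obtain e where e: "e > 0" "cball x e \<subseteq> U" using U x open_contains_cball by blast
    \<comment> \<open>The box is small enough for the differentiation theorem and, as its diameter is at most \<open>DIM('a)\<close> times its side,
      for being contained in \<open>U\<close>.\<close>
    define h where "h = min (d / 2) (e / (DIM('a) + 1))"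
    have h: "0 < h" "h < d" "h * DIM('a) \<le> e"
    proof -
      show "0 < h" "h < d" using d e by (auto simp: h_def)
      have "h * DIM('a) \<le> e / (DIM('a) + 1) * DIM('a)"
        by (intro mult_right_mono) (auto simp: h_def)
      also have "\<dots> \<le> e" using e by (simp add: field_simps)
      finally show "h * DIM('a) \<le> e" .
    qed
    have "cbox x (x + h *\<^sub>R One) \<subseteq> U"
    proof
      fix y assume y: "y \<in> cbox x (x + h *\<^sub>R One)"
      have "norm (y - x) \<le> (\<Sum>b\<in>Basis. \<bar>(y - x) \<bullet> b\<bar>)" by (rule norm_le_l1)
      also have "\<dots> \<le> (\<Sum>b\<in>(Basis::'a set). h)"
        using y by (intro sum_mono) (auto simp: mem_box inner_simps algebra_simps)
      also have "\<dots> \<le> e" using h by (simp add: mult.commute)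
      finally show "y \<in> U" using e by (auto simp: dist_norm norm_minus_commute)
    qed
    then have "0 \<le> integral (cbox x (x + h *\<^sub>R One)) w' /\<^sub>R h ^ DIM('a)"
      using box h unfolding eq by simp
    moreover have "norm (integral (cbox x (x + h *\<^sub>R One)) w' /\<^sub>R h ^ DIM('a) - w x) < - w x"
      using d h w'x by metis
    ultimately show False by auto
  qed
  have "AE x in lebesgue. x \<notin> N"
    using N by (simp add: negligible_iff_null_sets AE_not_in)
  then have "AE x in lebesgue_on \<Omega>. x \<notin> N"
    using \<Omega> by (subst AE_restrict_space_iff) (auto elim: eventually_mono)
  then show ?thesis by eventually_elim (use pt in blast)
qed

context cone_mollifier
begin

lemma \<psi>_has_integral: "integrable lborel \<psi>" "(LBINT w. \<psi> w) = 1"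
proof -
  have "has_bochner_integral lborel \<psi> 1"
    using \<psi>_integral \<psi>_nonneg by (intro has_bochner_integral_nn_integral) auto
  then show "integrable lborel \<psi>" "(LBINT w. \<psi> w) = 1"
    by (auto simp: has_bochner_integral_iff)
qed

text \<open>
  Here the averaging operator acts in the other variable, as its adjoint on the indicator of \<open>B\<close>;
  the substitution $x = y - \epsilon w$ moves the dilation from $\psi$ to the indicator.
\<close>

lemma average_of_indicator:
  assumes B: "B \<in> sets borel" "B \<subseteq> \<Omega>" and \<epsilon>: "0 < \<epsilon>"
  shows "(LINT x|M. indicator B x * ((1 / \<epsilon>\<^sup>2) * \<psi> ((1 / \<epsilon>) *\<^sub>R (y - x))))
    = (LBINT w. \<psi> w * indicator B (y + (- \<epsilon>) *\<^sub>R w))"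
proof -
  let ?F = "\<lambda>x. indicator B x * ((1 / \<epsilon>\<^sup>2) * \<psi> ((1 / \<epsilon>) *\<^sub>R (y - x)))"
  have [measurable]: "B \<in> sets borel" by fact
  have meas [measurable]: "?F \<in> borel_measurable borel" by measurable
  have "(LINT x|M. ?F x) = (LINT x|lebesgue. indicator \<Omega> x *\<^sub>R ?F x)"
    using \<Omega>_sets by (intro integral_restrict_space) auto
  also have "\<dots> = (LINT x|lebesgue. ?F x)"
    using B by (intro Bochner_Integration.integral_cong) (auto simp: indicator_def)
  also have "\<dots> = (LBINT x. ?F x)" by (rule integral_completion) (use meas in simp)
  also have "\<dots> = integral\<^sup>L (density (distr lborel borel (\<lambda>w. y + (- \<epsilon>) *\<^sub>R w)) (\<lambda>_. ennreal (\<bar>- \<epsilon>\<bar> ^ DIM(real^2)))) ?F"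
    using \<epsilon> by (subst lborel_affine[of "- \<epsilon>" y, symmetric]) auto
  also have "\<dots> = (LINT x|distr lborel borel (\<lambda>w. y + (- \<epsilon>) *\<^sub>R w). \<epsilon>\<^sup>2 *\<^sub>R ?F x)"
    using \<epsilon> by (subst integral_density) auto
  also have "\<dots> = (LBINT w. \<epsilon>\<^sup>2 *\<^sub>R ?F (y + (- \<epsilon>) *\<^sub>R w))"
  proof (rule integral_distr)
    have "(\<lambda>w. y + (- \<epsilon>) *\<^sub>R w) \<in> borel \<rightarrow>\<^sub>M borel"
      by (intro borel_measurable_continuous_onI continuous_intros)
    then show "(\<lambda>w. y + (- \<epsilon>) *\<^sub>R w) \<in> lborel \<rightarrow>\<^sub>M borel" by simp
    show "(\<lambda>x. \<epsilon>\<^sup>2 *\<^sub>R ?F x) \<in> borel_measurable borel"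
      using meas by (intro borel_measurable_scaleR borel_measurable_const)
  qed
  also have "\<dots> = (LBINT w. \<psi> w * indicator B (y + (- \<epsilon>) *\<^sub>R w))"
    using \<epsilon> by (intro Bochner_Integration.integral_cong) auto
  finally show ?thesis .
qed

lemma average_of_indicator_bounds:
  assumes [measurable]: "B \<in> sets borel"
  shows "\<bar>LBINT w. \<psi> w * indicator B (y + r *\<^sub>R w)\<bar> \<le> 1"
proof -
  have int: "integrable lborel (\<lambda>w. \<psi> w * indicator B (y + r *\<^sub>R w))"
    by (rule Bochner_Integration.integrable_bound[OF \<psi>_has_integral(1)])
       (auto simp: indicator_def \<psi>_nonneg)
  have "(LBINT w. \<psi> w * indicator B (y + r *\<^sub>R w)) \<le> (LBINT w. \<psi> w)"
    by (rule integral_mono[OF int \<psi>_has_integral(1)]) (auto simp: indicator_def \<psi>_nonneg)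
  moreover have "0 \<le> (LBINT w. \<psi> w * indicator B (y + r *\<^sub>R w))"
    by (rule integral_nonneg_AE) (auto simp: indicator_def \<psi>_nonneg)
  ultimately show ?thesis by (simp add: \<psi>_has_integral(2))
qed

lemma average_of_indicator_tendsto:
  assumes B: "closed B" and y: "y \<notin> frontier B" and e: "e \<longlonglongrightarrow> 0"
  shows "(\<lambda>n. LBINT w. \<psi> w * indicator B (y + (- e n) *\<^sub>R w)) \<longlonglongrightarrow> (indicator B y :: real)"
proof -
  have [measurable]: "B \<in> sets borel" using B by simp
  have "(\<lambda>n. LBINT w. \<psi> w * indicator B (y + (- e n) *\<^sub>R w)) \<longlonglongrightarrow> (LBINT w. \<psi> w * indicator B y)"
  proof (rule integral_dominated_convergence[where w = \<psi>])
    show "AE w in lborel. (\<lambda>n. \<psi> w * indicator B (y + (- e n) *\<^sub>R w)) \<longlonglongrightarrow> \<psi> w * indicator B y"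
    proof (rule AE_I2, rule tendsto_mult_left, rule tendsto_eventually)
      fix w
      have lim: "(\<lambda>n. y + (- e n) *\<^sub>R w) \<longlonglongrightarrow> y + (- 0) *\<^sub>R w"
        by (intro tendsto_intros e)
      show "\<forall>\<^sub>F n in sequentially. indicator B (y + (- e n) *\<^sub>R w) = (indicator B y :: real)"
      proof (cases "y \<in> B")
        case True
        then have "y \<in> interior B" using y B by (simp add: frontier_def)
        then have "\<forall>\<^sub>F n in sequentially. y + (- e n) *\<^sub>R w \<in> interior B"
          using topological_tendstoD[OF lim open_interior[of B]] by simp
        then show ?thesis
          by eventually_elim (use True interior_subset in \<open>auto simp: indicator_def\<close>)
      next
        case False
        then have "\<forall>\<^sub>F n in sequentially. y + (- e n) *\<^sub>R w \<in> - B"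
          using topological_tendstoD[OF lim, of "- B"] B by (simp add: open_Compl)
        then show ?thesis by eventually_elim (use False in auto)
      qed
    qed
  qed (auto simp: \<psi>_has_integral indicator_def \<psi>_nonneg)
  then show ?thesis by (simp add: \<psi>_has_integral)
qed

text \<open>
  By Fubini's theorem the integral of the averages of \<open>f\<close> over a box is the integral of \<open>f\<close> against averages of the
  indicator of the box, which converge boundedly to the indicator off the boundary of the box. Hence the bound for the
  averages of \<open>f\<close> passes to the integral of \<open>f\<close> itself.
\<close>

lemma box_integral_bound:
  assumes f: "integrable M f" and H: "integrable M H" "\<And>x. 0 \<le> H x"
    and B: "cbox a b \<subseteq> \<Omega>"
    and bd: "\<And>\<epsilon>. 0 < \<epsilon> \<Longrightarrow> \<epsilon> \<le> 1 \<Longrightarrow> AE x in M. x \<in> cbox a b \<longrightarrow>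
        \<bar>LINT y|M. f y * ((1 / \<epsilon>\<^sup>2) * \<psi> ((1 / \<epsilon>) *\<^sub>R (y - x)))\<bar> \<le> H x"
  shows "\<bar>LINT y|M. indicator (cbox a b) y * f y\<bar> \<le> (LINT x|M. indicator (cbox a b) x * H x)"
proof -
  interpret M: finite_measure M by (rule finite_measure_M)
  interpret P: pair_sigma_finite M M ..
  let ?B = "cbox a b"
  let ?A = "\<lambda>\<epsilon> x. LINT y|M. f y * ((1 / \<epsilon>\<^sup>2) * \<psi> ((1 / \<epsilon>) *\<^sub>R (y - x)))"
  let ?u = "\<lambda>\<epsilon> y. LBINT w. \<psi> w * indicator ?B (y + (- \<epsilon>) *\<^sub>R w)"
  have [measurable]: "f \<in> borel_measurable M" "H \<in> borel_measurable M" using f H by auto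
  have bnd: "\<bar>LINT y|M. f y * ?u \<epsilon> y\<bar> \<le> (LINT x|M. indicator ?B x * H x)" if \<epsilon>: "0 < \<epsilon>" "\<epsilon> \<le> 1" for \<epsilon>
  proof -
    let ?k = "\<lambda>y x. indicator ?B x * ((1 / \<epsilon>\<^sup>2) * \<psi> ((1 / \<epsilon>) *\<^sub>R (y - x)))"
    have int: "integrable (M \<Otimes>\<^sub>M M) (\<lambda>(y, x). f y * ?k y x)"
    proof (rule P.integrable_times_bounded_kernel[OF f, where C = "\<Psi> / \<epsilon>\<^sup>2" and A = \<Omega>])
      show "(\<lambda>(y, x). ?k y x) \<in> borel_measurable (M \<Otimes>\<^sub>M M)" by measurable
      show "\<bar>?k y x\<bar> \<le> \<Psi> / \<epsilon>\<^sup>2 * indicator \<Omega> x" if "x \<in> space M" for y x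
        using that \<psi>_le \<epsilon> by (auto simp: indicator_def abs_mult divide_right_mono)
      show "\<Omega> \<in> sets M" using sets.top[of M] by simp
      show "emeasure M \<Omega> < \<infinity>" using M.emeasure_finite[of \<Omega>] by (metis infinity_ennreal_def less_top)
    qed
    have "(LINT y|M. f y * ?u \<epsilon> y) = (LINT y|M. f y * (LINT x|M. ?k y x))"
      using B \<epsilon> by (subst average_of_indicator[OF _ B]) auto
    also have "\<dots> = (LINT y|M. (LINT x|M. f y * ?k y x))" by (simp only: integral_mult_right_zero)
    also have "\<dots> = (LINT x|M. (LINT y|M. f y * ?k y x))"
      by (rule P.Fubini_integral[OF int, symmetric])
    also have "\<dots> = (LINT x|M. indicator ?B x * ?A \<epsilon> x)"
      by (simp only: mult.left_commute[of "f _" "indicator _ _"] integral_mult_right_zero)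
    finally have eq: "(LINT y|M. f y * ?u \<epsilon> y) = (LINT x|M. indicator ?B x * ?A \<epsilon> x)" .
    have "integrable M (\<lambda>x. LINT y|M. f y * ?k y x)" using P.integrable_snd[OF int] .
    then have intA: "integrable M (\<lambda>x. indicator ?B x * ?A \<epsilon> x)"
      by (simp only: mult.left_commute[of "f _" "indicator _ _"] integral_mult_right_zero)
    have "\<bar>LINT x|M. indicator ?B x * ?A \<epsilon> x\<bar> \<le> (LINT x|M. \<bar>indicator ?B x * ?A \<epsilon> x\<bar>)"
      by (rule integral_abs_bound)
    also have "\<dots> \<le> (LINT x|M. indicator ?B x * H x)"
    proof (rule integral_mono_AE)
      show "integrable M (\<lambda>x. \<bar>indicator ?B x * ?A \<epsilon> x\<bar>)" using intA by (rule integrable_abs)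
      show "integrable M (\<lambda>x. indicator ?B x * H x)"
        by (rule Bochner_Integration.integrable_bound[OF H(1)]) (auto simp: indicator_def)
      show "AE x in M. \<bar>indicator ?B x * ?A \<epsilon> x\<bar> \<le> indicator ?B x * H x"
        using bd[OF \<epsilon>] by eventually_elim (auto simp: indicator_def)
    qed
    finally show ?thesis unfolding eq .
  qed
  define e where "e n = 1 / real (Suc n)" for n
  have e: "0 < e n" "e n \<le> 1" for n by (auto simp: e_def)
  have e0: "e \<longlonglongrightarrow> 0" unfolding e_def using LIMSEQ_inverse_real_of_nat by (simp add: inverse_eq_divide)
  have "(\<lambda>n. LINT y|M. f y * ?u (e n) y) \<longlonglongrightarrow> (LINT y|M. f y * indicator ?B y)"
  proof (rule integral_dominated_convergence[where w = "\<lambda>y. \<bar>f y\<bar>"])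
    have "AE y in lebesgue. y \<notin> frontier ?B"
      using negligible_convex_frontier[of ?B] by (simp add: negligible_iff_null_sets AE_not_in)
    then have "AE y in M. y \<notin> frontier ?B" 
      using \<Omega>_sets by (subst AE_restrict_space_iff) (auto elim: eventually_mono)
    then show "AE y in M. (\<lambda>n. f y * ?u (e n) y) \<longlonglongrightarrow> f y * indicator ?B y"
      by eventually_elim (intro tendsto_mult_left average_of_indicator_tendsto e0 closed_cbox)
    show "AE y in M. norm (f y * ?u (e n) y) \<le> \<bar>f y\<bar>" for n
      using average_of_indicator_bounds[of ?B _ "- e n"]
      by (intro AE_I2) (simp add: abs_mult mult_left_le)
    show "(\<lambda>y. f y * ?u (e n) y) \<in> borel_measurable M" for n
    proof -
      have "(\<lambda>y. ?u (e n) y) \<in> borel_measurable borel"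
        by (rule lborel.borel_measurable_lebesgue_integral) measurable
      then show ?thesis by measurable
    qed
  qed (use f in auto)
  then have "(\<lambda>n. \<bar>LINT y|M. f y * ?u (e n) y\<bar>) \<longlonglongrightarrow> \<bar>LINT y|M. f y * indicator ?B y\<bar>"
    by (rule tendsto_rabs)
  then have "\<bar>LINT y|M. f y * indicator ?B y\<bar> \<le> (LINT x|M. indicator ?B x * H x)"
    by (rule LIMSEQ_le_const2) (use bnd e in blast)
  then show ?thesis by (simp only: mult.commute)
qed

text \<open>
  Both $H - f$ and $H + f$, with $H$ the right-hand side, have nonnegative integrals over all
  boxes inside the domain and the ball. The
  finiteness assumption makes $H$ finite almost everywhere and integrable.
\<close>

lemma local_pointwise_bound:
  assumes cone: "local_cone \<Omega> z \<rho> c s"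
    and wp: "\<And>b. b \<in> Basis \<Longrightarrow> weak_partial \<Omega> b f (h b)"
    and f: "integrable M f" and h: "\<And>b. b \<in> Basis \<Longrightarrow> integrable M (h b)"
    and fin: "(\<integral>\<^sup>+ x. (\<integral>\<^sup>+ y. ennreal ((\<Sum>b\<in>Basis. \<bar>h b y\<bar>) / norm (x - y)) \<partial>M) \<partial>M) < \<infinity>"
  shows "AE x in M. x \<in> ball z \<rho> \<longrightarrow> ennreal \<bar>f x\<bar> \<le> ennreal (\<Psi> * (1 + R\<^sup>2)) *
     ((\<integral>\<^sup>+ y. ennreal \<bar>f y\<bar> \<partial>M) + (\<integral>\<^sup>+ y. ennreal ((\<Sum>b\<in>Basis. \<bar>h b y\<bar>) / norm (x - y)) \<partial>M))"
proof -
  interpret M: finite_measure M by (rule finite_measure_M)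
  have [measurable]: "f \<in> borel_measurable M" using f by simp
  have hm [measurable]: "b \<in> Basis \<Longrightarrow> h b \<in> borel_measurable M" for b using h by simp
  define E where "E x = ennreal (\<Psi> * (1 + R\<^sup>2)) * ((\<integral>\<^sup>+ y. ennreal \<bar>f y\<bar> \<partial>M)
     + (\<integral>\<^sup>+ y. ennreal ((\<Sum>b\<in>Basis. \<bar>h b y\<bar>) / norm (x - y)) \<partial>M))" for x
  define H where "H x = enn2real (E x)" for x
  have [measurable]: "E \<in> borel_measurable M" unfolding E_def by measurable
  then have [measurable]: "H \<in> borel_measurable M" unfolding H_def by measurable
  have "(\<integral>\<^sup>+ y. ennreal \<bar>f y\<bar> \<partial>M) < \<infinity>" using f by (simp add: integrable_iff_bounded)
  then have "(\<integral>\<^sup>+ x. (\<integral>\<^sup>+ y. ennreal \<bar>f y\<bar> \<partial>M) \<partial>M) < \<infinity>"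
  proof -
    have "emeasure M \<Omega> < top" using M.emeasure_finite[of \<Omega>] by (metis infinity_ennreal_def less_top)
    then show ?thesis using \<open>(\<integral>\<^sup>+ y. ennreal \<bar>f y\<bar> \<partial>M) < \<infinity>\<close>
      by (simp add: ennreal_mult_less_top)
  qed
  then have Efin: "(\<integral>\<^sup>+ x. E x \<partial>M) < \<infinity>"
    unfolding E_def using fin by (simp add: nn_integral_cmult nn_integral_add ennreal_mult_less_top)
  then have AE_fin: "AE x in M. E x \<noteq> \<infinity>"
    by (intro nn_integral_PInf_AE) auto
  then have AE_H: "AE x in M. ennreal (H x) = E x"
    by eventually_elim (auto simp: H_def top.not_eq_extremum)
  have H: "integrable M H" "\<And>x. 0 \<le> H x"
  proof -
    show H0: "0 \<le> H x" for x by (simp add: H_def)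
    have "(\<integral>\<^sup>+ x. ennreal (norm (H x)) \<partial>M) = (\<integral>\<^sup>+ x. E x \<partial>M)"
      using AE_H by (intro nn_integral_cong_AE) (auto simp: H0)
    then show "integrable M H" using Efin by (intro integrableI_bounded) auto
  qed
  define U where "U = \<Omega> \<inter> ball z \<rho>"
  have U: "open U" "U \<subseteq> \<Omega>" using open_\<Omega> by (auto simp: U_def)
  have box: "\<bar>LINT y|M. indicator (cbox a b) y * f y\<bar> \<le> (LINT x|M. indicator (cbox a b) x * H x)"
    if "cbox a b \<subseteq> U" for a b
  proof (rule box_integral_bound[OF f H])
    show "cbox a b \<subseteq> \<Omega>" using that U by blast
    fix \<epsilon> :: real assume \<epsilon>: "0 < \<epsilon>" "\<epsilon> \<le> 1"
    show "AE x in M. x \<in> cbox a b \<longrightarrow>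
        \<bar>LINT y|M. f y * ((1 / \<epsilon>\<^sup>2) * \<psi> ((1 / \<epsilon>) *\<^sub>R (y - x)))\<bar> \<le> H x"
      using AE_H
    proof eventually_elim
      case (elim x)
      show ?case
      proof
        assume "x \<in> cbox a b"
        then have x: "x \<in> \<Omega>" "x \<in> ball z \<rho>" using that by (auto simp: U_def)
        have "ennreal \<bar>LINT y|M. f y * ((1 / \<epsilon>\<^sup>2) * \<psi> ((1 / \<epsilon>) *\<^sub>R (y - x)))\<bar> \<le> E x"
          unfolding E_def using x cone
          by (intro average_bound[OF wp f h \<epsilon> x(1)]) (auto simp: local_cone_def)
        then show "\<bar>LINT y|M. f y * ((1 / \<epsilon>\<^sup>2) * \<psi> ((1 / \<epsilon>) *\<^sub>R (y - x)))\<bar> \<le> H x"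
          unfolding elim[symmetric] ennreal_le_iff[OF H(2)] .
      qed
    qed
  qed
  have intB: "integrable M (\<lambda>y. indicator (cbox a b) y * g y)" if "integrable M g" for a b and g :: "real^2 \<Rightarrow> real"
    using that by (intro Bochner_Integration.integrable_bound[OF that]) (auto simp: indicator_def)
  have "AE x in M. x \<in> U \<longrightarrow> 0 \<le> H x - f x"
  proof (rule AE_nonneg_of_box_integrals[OF \<Omega>_sets _ U])
    show "integrable M (\<lambda>x. H x - f x)" using H f by simp
    show "0 \<le> (LINT y|M. indicator (cbox a b) y * (H y - f y))" if "cbox a b \<subseteq> U" for a b
      unfolding right_diff_distrib Bochner_Integration.integral_diff[OF intB[OF H(1)] intB[OF f]]
      using box[OF that] by linarith
  qed
  moreover have "AE x in M. x \<in> U \<longrightarrow> 0 \<le> H x + f x"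
  proof (rule AE_nonneg_of_box_integrals[OF \<Omega>_sets _ U])
    show "integrable M (\<lambda>x. H x + f x)" using H f by simp
    show "0 \<le> (LINT y|M. indicator (cbox a b) y * (H y + f y))" if "cbox a b \<subseteq> U" for a b
      unfolding distrib_left Bochner_Integration.integral_add[OF intB[OF H(1)] intB[OF f]]
      using box[OF that] by linarith
  qed
  ultimately have "AE x in M. x \<in> ball z \<rho> \<longrightarrow> ennreal \<bar>f x\<bar> \<le> E x"
    using AE_H AE_space
  proof eventually_elim
    case (elim x)
    show ?case
    proof
      assume "x \<in> ball z \<rho>"
      then have "\<bar>f x\<bar> \<le> H x" using elim by (auto simp: U_def)
      then show "ennreal \<bar>f x\<bar> \<le> E x" unfolding elim(3)[symmetric] by (rule ennreal_leI)
    qed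
  qed
  then show ?thesis unfolding E_def .
qed

end

lemma local_bound_exists:
  assumes \<Omega>: "smooth_bounded_domain \<Omega>" and z: "z \<in> closure \<Omega>"
  shows "\<exists>\<rho>>0. \<exists>C\<ge>0. \<forall>f h. (\<forall>b\<in>Basis. weak_partial \<Omega> b f (h b)) \<longrightarrow> integrable (lebesgue_on \<Omega>) f \<longrightarrow>
      (\<forall>b\<in>Basis. integrable (lebesgue_on \<Omega>) (h b)) \<longrightarrow>
      (\<integral>\<^sup>+ x. (\<integral>\<^sup>+ y. ennreal ((\<Sum>b\<in>Basis. \<bar>h b y\<bar>) / norm (x - y)) \<partial>lebesgue_on \<Omega>) \<partial>lebesgue_on \<Omega>) < \<infinity> \<longrightarrow>
      (AE x in lebesgue_on \<Omega>. x \<in> ball z \<rho> \<longrightarrow> ennreal \<bar>f x\<bar> \<le> ennreal C *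
        ((\<integral>\<^sup>+ y. ennreal \<bar>f y\<bar> \<partial>lebesgue_on \<Omega>)
          + (\<integral>\<^sup>+ y. ennreal ((\<Sum>b\<in>Basis. \<bar>h b y\<bar>) / norm (x - y)) \<partial>lebesgue_on \<Omega>)))"
proof -
  have "open \<Omega>" "bounded \<Omega>" "smooth_boundary \<Omega>"
    using \<Omega> by (auto simp: smooth_bounded_domain_def)
  then obtain \<rho> c s where cone: "local_cone \<Omega> z \<rho> c s"
    using smooth_boundary_local_cone z by blast
  then have "\<rho> > 0" "s > 0" by (auto simp: local_cone_def)
  obtain \<psi> where "smooth_fun \<psi>" "\<And>w. \<psi> w \<ge> 0" "\<And>w. w \<notin> cball c s \<Longrightarrow> \<psi> w = 0"
    "(\<integral>\<^sup>+ w. ennreal (\<psi> w) \<partial>lborel) = 1"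
    using smooth_bump_exists[OF \<open>s > 0\<close>, of c] by blast
  then interpret cone_mollifier \<Omega> c s \<psi>
    using \<open>open \<Omega>\<close> \<open>bounded \<Omega>\<close> by unfold_locales
  have C: "0 \<le> \<Psi> * (1 + R\<^sup>2)" using \<psi>_le(3) by simp
  show ?thesis
    by (intro exI[of _ \<rho>] exI[of _ "\<Psi> * (1 + R\<^sup>2)"] conjI allI impI local_pointwise_bound[OF cone] C \<open>\<rho> > 0\<close>)
       blast+
qed

text \<open>
  The closure of the domain is compact, so finitely many of the local bounds suffice, and the sum of their
  constants serves everywhere. The constant has to be chosen before \<open>f\<close> and \<open>h\<close>.
\<close>

lemma pointwise_bound:
  assumes \<Omega>: "smooth_bounded_domain \<Omega>"
  obtains C where "C \<ge> 0" "\<And>f h. (\<And>b. b \<in> Basis \<Longrightarrow> weak_partial \<Omega> b f (h b)) \<Longrightarrow>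
      integrable (lebesgue_on \<Omega>) f \<Longrightarrow> (\<And>b. b \<in> Basis \<Longrightarrow> integrable (lebesgue_on \<Omega>) (h b)) \<Longrightarrow>
      (\<integral>\<^sup>+ x. (\<integral>\<^sup>+ y. ennreal ((\<Sum>b\<in>Basis. \<bar>h b y\<bar>) / norm (x - y)) \<partial>lebesgue_on \<Omega>) \<partial>lebesgue_on \<Omega>) < \<infinity> \<Longrightarrow>
      (AE x in lebesgue_on \<Omega>. ennreal \<bar>f x\<bar> \<le> ennreal C *
        ((\<integral>\<^sup>+ y. ennreal \<bar>f y\<bar> \<partial>lebesgue_on \<Omega>)
          + (\<integral>\<^sup>+ y. ennreal ((\<Sum>b\<in>Basis. \<bar>h b y\<bar>) / norm (x - y)) \<partial>lebesgue_on \<Omega>)))"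
proof -
  let ?M = "lebesgue_on \<Omega>"
  let ?I = "\<lambda>h x. \<integral>\<^sup>+ y. ennreal ((\<Sum>b\<in>Basis. \<bar>h b y\<bar>) / norm (x - y)) \<partial>?M"
  define P where "P z r C \<longleftrightarrow> (\<forall>f h. (\<forall>b\<in>Basis. weak_partial \<Omega> b f (h b)) \<longrightarrow> integrable ?M f \<longrightarrow>
      (\<forall>b\<in>Basis. integrable ?M (h b)) \<longrightarrow> (\<integral>\<^sup>+ x. ?I h x \<partial>?M) < \<infinity> \<longrightarrow>
      (AE x in ?M. x \<in> ball z r \<longrightarrow> ennreal \<bar>f x\<bar> \<le> ennreal C *
        ((\<integral>\<^sup>+ y. ennreal \<bar>f y\<bar> \<partial>?M) + ?I h x)))" for z r C
  have "\<forall>z\<in>closure \<Omega>. \<exists>r C. r > 0 \<and> C \<ge> 0 \<and> P z r C"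
    using local_bound_exists[OF \<Omega>] unfolding P_def by blast
  then obtain \<rho> Cz where \<rho>: "\<And>z. z \<in> closure \<Omega> \<Longrightarrow> \<rho> z > 0"
    and Cz: "\<And>z. z \<in> closure \<Omega> \<Longrightarrow> Cz z \<ge> 0" and P: "\<And>z. z \<in> closure \<Omega> \<Longrightarrow> P z (\<rho> z) (Cz z)"
    by metis
  have cpt: "compact (closure \<Omega>)" using \<Omega> by (auto simp: smooth_bounded_domain_def)
  have "closure \<Omega> \<subseteq> (\<Union>z\<in>closure \<Omega>. ball z (\<rho> z))" using \<rho> by force
  then obtain Z where Z: "Z \<subseteq> closure \<Omega>" "finite Z" and cov: "closure \<Omega> \<subseteq> (\<Union>z\<in>Z. ball z (\<rho> z))"
    using compactE_image[OF cpt, of "closure \<Omega>" "\<lambda>z. ball z (\<rho> z)"] by (metis open_ball)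
  have CzZ: "Cz z \<le> (\<Sum>z\<in>Z. Cz z)" if "z \<in> Z" for z
    using Z Cz that by (intro member_le_sum) auto
  show thesis
  proof (rule that[of "\<Sum>z\<in>Z. Cz z"])
    show "0 \<le> (\<Sum>z\<in>Z. Cz z)" using Z Cz by (intro sum_nonneg) auto
    fix f :: "real^2 \<Rightarrow> real" and h :: "real^2 \<Rightarrow> real^2 \<Rightarrow> real"
    assume a: "\<And>b. b \<in> Basis \<Longrightarrow> weak_partial \<Omega> b f (h b)" "integrable ?M f"
      "\<And>b. b \<in> Basis \<Longrightarrow> integrable ?M (h b)" "(\<integral>\<^sup>+ x. ?I h x \<partial>?M) < \<infinity>"
    have "AE x in ?M. \<forall>z\<in>Z. x \<in> ball z (\<rho> z) \<longrightarrow> ennreal \<bar>f x\<bar> \<le> ennreal (Cz z) *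
        ((\<integral>\<^sup>+ y. ennreal \<bar>f y\<bar> \<partial>?M) + ?I h x)"
      using P Z(1) a unfolding P_def by (intro AE_finite_allI[OF Z(2)]) blast
    then show "AE x in ?M. ennreal \<bar>f x\<bar> \<le> ennreal (\<Sum>z\<in>Z. Cz z) * ((\<integral>\<^sup>+ y. ennreal \<bar>f y\<bar> \<partial>?M) + ?I h x)"
      using AE_space
    proof eventually_elim
      case (elim x)
      then have "x \<in> closure \<Omega>" using closure_subset[of \<Omega>] by auto
      then obtain z where z: "z \<in> Z" "x \<in> ball z (\<rho> z)" using cov by blast
      then have "ennreal \<bar>f x\<bar> \<le> ennreal (Cz z) * ((\<integral>\<^sup>+ y. ennreal \<bar>f y\<bar> \<partial>?M) + ?I h x)"
        using elim by blast
      also have "\<dots> \<le> ennreal (\<Sum>z\<in>Z. Cz z) * ((\<integral>\<^sup>+ y. ennreal \<bar>f y\<bar> \<partial>?M) + ?I h x)"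
        using CzZ[OF z(1)] by (intro mult_right_mono ennreal_leI) auto
      finally show ?case .
    qed
  qed
qed

section \<open>The Sobolev embedding with its growth rate\<close>

lemma Lp_norm_nonneg: "0 \<le> Lp_norm p \<Omega> f"
  by (simp add: Lp_norm_def)

lemma nn_integral_Lp_norm:
  assumes "f \<in> Lp_space p \<Omega>" "0 < p"
  shows "(\<integral>\<^sup>+ x. ennreal (\<bar>f x\<bar> powr p) \<partial>lebesgue_on \<Omega>) = ennreal (Lp_norm p \<Omega> f powr p)"
  using assms by (simp add: Lp_space_def Lp_norm_def powr_powr nn_integral_eq_integral)

lemma abs_powr_2: "\<bar>x::real\<bar> powr 2 = x\<^sup>2"
  by (cases "x = 0") (auto simp: powr_numeral)

lemma nn_integral_L2_norm:
  assumes "f \<in> Lp_space 2 \<Omega>"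
  shows "(\<integral>\<^sup>+ x. ennreal ((f x)\<^sup>2) \<partial>lebesgue_on \<Omega>) = ennreal ((Lp_norm 2 \<Omega> f)\<^sup>2)"
  using nn_integral_Lp_norm[OF assms] Lp_norm_nonneg[of 2 \<Omega> f] abs_powr_2[of "Lp_norm 2 \<Omega> f"]
  by (simp add: abs_powr_2)

lemma Lp_norm_2_le:
  assumes [measurable]: "f \<in> borel_measurable (lebesgue_on \<Omega>)"
    and le: "(\<integral>\<^sup>+ x. ennreal ((f x)\<^sup>2) \<partial>lebesgue_on \<Omega>) \<le> ennreal (B\<^sup>2)" and B: "0 \<le> B"
  shows "f \<in> Lp_space 2 \<Omega>" "Lp_norm 2 \<Omega> f \<le> B"
proof -
  have "integrable (lebesgue_on \<Omega>) (\<lambda>x. (f x)\<^sup>2)"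
    using le by (intro integrableI_bounded) (auto simp: le_less_trans)
  then show f: "f \<in> Lp_space 2 \<Omega>" by (simp add: Lp_space_def abs_powr_2)
  have "(Lp_norm 2 \<Omega> f)\<^sup>2 \<le> B\<^sup>2"
    using le nn_integral_L2_norm[OF f] by (simp add: ennreal_le_iff)
  then show "Lp_norm 2 \<Omega> f \<le> B" using B by (rule power2_le_imp_le)
qed

lemma nn_integral_abs_square_le:
  assumes "\<Omega> \<in> lmeasurable" and [measurable]: "f \<in> borel_measurable (lebesgue_on \<Omega>)"
  shows "(\<integral>\<^sup>+ x. ennreal \<bar>f x\<bar> \<partial>lebesgue_on \<Omega>)\<^sup>2
    \<le> ennreal (measure lebesgue \<Omega>) * (\<integral>\<^sup>+ x. ennreal ((f x)\<^sup>2) \<partial>lebesgue_on \<Omega>)"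
proof -
  have "(\<integral>\<^sup>+ x. 1 * ennreal \<bar>f x\<bar> \<partial>lebesgue_on \<Omega>)\<^sup>2
      \<le> (\<integral>\<^sup>+ x. 1\<^sup>2 \<partial>lebesgue_on \<Omega>) * (\<integral>\<^sup>+ x. (ennreal \<bar>f x\<bar>)\<^sup>2 \<partial>lebesgue_on \<Omega>)"
    by (rule Cauchy_Schwarz_nn_integral) auto
  moreover have "emeasure (lebesgue_on \<Omega>) \<Omega> = ennreal (measure lebesgue \<Omega>)"
    using assms(1) by (simp add: emeasure_restrict_space fmeasurableD emeasure_eq_measure2)
  ultimately show ?thesis by (simp add: ennreal_power)
qed

lemma H1_weak_deriv:
  assumes "f \<in> H1_space \<Omega>" "b \<in> Basis"
  shows "weak_deriv \<Omega> b f \<in> Lp_space 2 \<Omega>" "weak_partial \<Omega> b f (weak_deriv \<Omega> b f)"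
proof -
  have "\<exists>h. h \<in> Lp_space 2 \<Omega> \<and> weak_partial \<Omega> b f h"
    using assms by (auto simp: H1_space_def)
  from someI_ex[OF this] show "weak_deriv \<Omega> b f \<in> Lp_space 2 \<Omega>" "weak_partial \<Omega> b f (weak_deriv \<Omega> b f)"
    unfolding weak_deriv_def by auto
qed

lemma L2_integrable:
  assumes "\<Omega> \<in> lmeasurable" "f \<in> Lp_space 2 \<Omega>"
  shows "integrable (lebesgue_on \<Omega>) f"
proof (rule integrableI_bounded)
  show meas: "f \<in> borel_measurable (lebesgue_on \<Omega>)" using assms by (simp add: Lp_space_def)
  have "(\<integral>\<^sup>+ x. ennreal \<bar>f x\<bar> \<partial>lebesgue_on \<Omega>)\<^sup>2 < \<infinity>"
    using nn_integral_abs_square_le[OF assms(1) meas] nn_integral_L2_norm[OF assms(2)]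
    by (simp add: ennreal_mult[symmetric] le_less_trans)
  then show "(\<integral>\<^sup>+ x. ennreal (norm (f x)) \<partial>lebesgue_on \<Omega>) < \<infinity>"
    by (simp add: power_less_top_ennreal)
qed

lemma ennreal_power_add_le:
  fixes a b :: ennreal
  shows "(a + b) ^ n \<le> 2 ^ n * (a ^ n + b ^ n)"
proof -
  have "(a + b) ^ n \<le> (2 * max a b) ^ n"
    by (intro power_mono) (auto simp: mult_2 add_mono)
  also have "\<dots> = 2 ^ n * max a b ^ n" by (rule power_mult_distrib)
  also have "\<dots> \<le> 2 ^ n * (a ^ n + b ^ n)"
    by (intro mult_left_mono) (auto simp: max_def)
  finally show ?thesis .
qed

text \<open>
  Integrate the $2m$-th power of the pointwise bound. The mean of $|f|$ is controlled by the $L^2$ norm, and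
  the integral of the $2m$-th power of the potential of $G = \sum_b |\partial_b f|$ by the $m$-th power of a multiple
  of $m \|G\|_2^2$. All other constants grow at most exponentially in $m$ and are absorbed into \<open>B\<close>.
\<close>

lemma H1_power_integral_bound:
  assumes \<Omega>: "smooth_bounded_domain \<Omega>"
  obtains B where "B \<ge> 0" "\<And>m f. m \<ge> 1 \<Longrightarrow> f \<in> H1_space \<Omega> \<Longrightarrow>
    (\<integral>\<^sup>+ x. ennreal (\<bar>f x\<bar> ^ (2 * m)) \<partial>lebesgue_on \<Omega>) \<le> ennreal ((B * real m * (H1_norm \<Omega> f)\<^sup>2) ^ m)"
proof -
  let ?M = "lebesgue_on \<Omega>"
  have sets: "\<Omega> \<in> sets lebesgue" and bdd: "bounded \<Omega>"
    using \<Omega> by (auto simp: smooth_bounded_domain_def)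
  then have lm: "\<Omega> \<in> lmeasurable" by (rule bounded_set_imp_lmeasurable[rotated])
  define \<mu> where "\<mu> = measure lebesgue \<Omega>"
  have \<mu>: "\<mu> \<ge> 0" "emeasure ?M \<Omega> = ennreal \<mu>"
    using lm by (simp_all add: \<mu>_def emeasure_restrict_space fmeasurableD emeasure_eq_measure2)
  interpret M: finite_measure ?M using lm by (rule finite_measure_lebesgue_on)
  note [measurable] = fst_snd_borel_lebesgue_on[where \<Omega>=\<Omega>]
  obtain C where C: "C \<ge> 0" and pt: "\<And>f h. (\<And>b. b \<in> Basis \<Longrightarrow> weak_partial \<Omega> b f (h b)) \<Longrightarrow>
      integrable ?M f \<Longrightarrow> (\<And>b. b \<in> Basis \<Longrightarrow> integrable ?M (h b)) \<Longrightarrow>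
      (\<integral>\<^sup>+ x. (\<integral>\<^sup>+ y. ennreal ((\<Sum>b\<in>Basis. \<bar>h b y\<bar>) / norm (x - y)) \<partial>?M) \<partial>?M) < \<infinity> \<Longrightarrow>
      (AE x in ?M. ennreal \<bar>f x\<bar> \<le> ennreal C * ((\<integral>\<^sup>+ y. ennreal \<bar>f y\<bar> \<partial>?M)
          + (\<integral>\<^sup>+ y. ennreal ((\<Sum>b\<in>Basis. \<bar>h b y\<bar>) / norm (x - y)) \<partial>?M)))"
    by (rule pointwise_bound[OF \<Omega>]) blast
  obtain K where K: "K > 0" and RP: "\<And>m G T. m \<ge> 1 \<Longrightarrow> G \<in> borel_measurable ?M \<Longrightarrow> (\<And>y. G y \<ge> 0) \<Longrightarrow> T \<ge> 0 \<Longrightarrow>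
       (\<integral>\<^sup>+ y. ennreal ((G y)\<^sup>2) \<partial>?M) \<le> ennreal T \<Longrightarrow>
       (\<integral>\<^sup>+ x. (\<integral>\<^sup>+ y. ennreal (G y / norm (x - y)) \<partial>?M) ^ (2 * m) \<partial>?M) \<le> ennreal (K * (K * real m * T) ^ m)"
    by (rule Riesz_potential_power_integral[OF bdd sets]) blast
  define Q where "Q = max 1 (max \<mu> (2 * K))"
  have Q: "Q \<ge> 1" "\<mu> \<le> Q" "2 * K \<le> Q" "K \<le> Q" using K by (auto simp: Q_def)
  show thesis
  proof (rule that[of "8 * C\<^sup>2 * Q\<^sup>2"])
    show "0 \<le> 8 * C\<^sup>2 * Q\<^sup>2" by simp
    fix m :: nat and f assume m: "m \<ge> 1" and f: "f \<in> H1_space \<Omega>"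
    define N where "N = H1_norm \<Omega> f"
    define h where "h b = weak_deriv \<Omega> b f" for b
    define G where "G y = (\<Sum>b\<in>Basis. \<bar>h b y\<bar>)" for y
    define I where "I x = (\<integral>\<^sup>+ y. ennreal (G y / norm (x - y)) \<partial>?M)" for x
    have h: "h b \<in> Lp_space 2 \<Omega>" "weak_partial \<Omega> b f (h b)" if "b \<in> Basis" for b
      using H1_weak_deriv[OF f that] by (auto simp: h_def)
    have fL: "f \<in> Lp_space 2 \<Omega>" using f by (simp add: H1_space_def)
    have hm [measurable]: "b \<in> Basis \<Longrightarrow> h b \<in> borel_measurable ?M" for b using h by (simp add: Lp_space_def)
    have fm [measurable]: "f \<in> borel_measurable ?M" using fL by (simp add: Lp_space_def)
    have Gm [measurable]: "G \<in> borel_measurable ?M" unfolding G_def by measurable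
    have Im [measurable]: "I \<in> borel_measurable ?M" unfolding I_def by measurable
    have N2: "N\<^sup>2 = (Lp_norm 2 \<Omega> f)\<^sup>2 + (\<Sum>b\<in>Basis. (Lp_norm 2 \<Omega> (h b))\<^sup>2)"
      unfolding N_def H1_norm_def h_def by (intro real_sqrt_pow2 add_nonneg_nonneg sum_nonneg) auto
    have fN: "(Lp_norm 2 \<Omega> f)\<^sup>2 \<le> N\<^sup>2" unfolding N2 by (simp add: sum_nonneg)
    have hN: "(\<Sum>b\<in>Basis. (Lp_norm 2 \<Omega> (h b))\<^sup>2) \<le> N\<^sup>2" unfolding N2 by simp
    have GT: "(\<integral>\<^sup>+ y. ennreal ((G y)\<^sup>2) \<partial>?M) \<le> ennreal (2 * N\<^sup>2)"
    proof -
      have "(\<integral>\<^sup>+ y. ennreal ((G y)\<^sup>2) \<partial>?M) \<le> (\<integral>\<^sup>+ y. 2 * (\<Sum>b\<in>Basis. ennreal ((h b y)\<^sup>2)) \<partial>?M)"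
      proof (rule nn_integral_mono)
        fix y
        have "(G y)\<^sup>2 \<le> 2 * (\<Sum>b\<in>Basis. (h b y)\<^sup>2)"
          using sum_squared_le_sum_of_squares[of "\<lambda>b. \<bar>h b y\<bar>" "Basis :: (real^2) set"]
          by (simp add: G_def mult.commute)
        then have "ennreal ((G y)\<^sup>2) \<le> ennreal (2 * (\<Sum>b\<in>Basis. (h b y)\<^sup>2))" by (rule ennreal_leI)
        then show "ennreal ((G y)\<^sup>2) \<le> 2 * (\<Sum>b\<in>Basis. ennreal ((h b y)\<^sup>2))"
          by (simp add: ennreal_mult sum_nonneg)
      qed
      also have "\<dots> = 2 * (\<Sum>b\<in>Basis. (\<integral>\<^sup>+ y. ennreal ((h b y)\<^sup>2) \<partial>?M))"
        by (subst nn_integral_cmult, measurable) (subst nn_integral_sum, auto)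
      also have "\<dots> = 2 * (\<Sum>b\<in>Basis. ennreal ((Lp_norm 2 \<Omega> (h b))\<^sup>2))"
        using h by (simp add: nn_integral_L2_norm cong: sum.cong)
      also have "\<dots> = ennreal (2 * (\<Sum>b\<in>Basis. (Lp_norm 2 \<Omega> (h b))\<^sup>2))"
        by (simp add: ennreal_mult sum_nonneg)
      also have "\<dots> \<le> ennreal (2 * N\<^sup>2)" using hN by (intro ennreal_leI) simp
      finally show ?thesis .
    qed
    have Ipow: "(\<integral>\<^sup>+ x. I x ^ (2 * k) \<partial>?M) \<le> ennreal (K * (K * real k * (2 * N\<^sup>2)) ^ k)" if "k \<ge> 1" for k
      unfolding I_def by (rule RP[OF that Gm _ _ GT]) (auto simp: G_def sum_nonneg)
    \<comment> \<open>The case \<open>k = 1\<close> shows that the potential is integrable, as the pointwise bound requires.\<close>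
    have "(\<integral>\<^sup>+ x. I x \<partial>?M) \<le> (\<integral>\<^sup>+ x. 1 + I x ^ (2 * 1) \<partial>?M)"
    proof (rule nn_integral_mono)
      fix x
      show "I x \<le> 1 + I x ^ (2 * 1)"
      proof (cases "I x \<le> 1")
        case False
        then have "I x * 1 \<le> I x * I x" by (intro mult_left_mono) auto
        then show ?thesis by (simp add: power2_eq_square add_increasing)
      qed (simp add: add_increasing2)
    qed
    also have "\<dots> = ennreal \<mu> + (\<integral>\<^sup>+ x. I x ^ (2 * 1) \<partial>?M)" by (simp add: nn_integral_add \<mu>)
    also have "\<dots> < \<infinity>" using Ipow[of 1] by (auto simp: ennreal_add_less_top le_less_trans)
    finally have Ifin: "(\<integral>\<^sup>+ x. I x \<partial>?M) < \<infinity>" .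
    define F where "F = (\<integral>\<^sup>+ y. ennreal \<bar>f y\<bar> \<partial>?M)"
    have F2: "F\<^sup>2 \<le> ennreal (\<mu> * N\<^sup>2)"
    proof -
      have "F\<^sup>2 \<le> ennreal \<mu> * ennreal ((Lp_norm 2 \<Omega> f)\<^sup>2)"
        unfolding F_def \<mu>_def nn_integral_L2_norm[OF fL, symmetric]
        by (rule nn_integral_abs_square_le[OF lm fm])
      also have "\<dots> \<le> ennreal \<mu> * ennreal (N\<^sup>2)" using fN by (intro mult_left_mono ennreal_leI) auto
      finally show ?thesis using \<mu> by (simp add: ennreal_mult)
    qed
    have "AE x in ?M. ennreal \<bar>f x\<bar> \<le> ennreal C * (F + I x)"
      using pt[OF h(2) L2_integrable[OF lm fL] L2_integrable[OF lm h(1)]] Ifin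
      unfolding F_def I_def G_def by blast
    then have "AE x in ?M. ennreal (\<bar>f x\<bar> ^ (2 * m)) \<le> ennreal ((4 * C\<^sup>2) ^ m) * (F ^ (2 * m) + I x ^ (2 * m))"
    proof eventually_elim
      case (elim x)
      have "ennreal (\<bar>f x\<bar> ^ (2 * m)) = ennreal \<bar>f x\<bar> ^ (2 * m)" by (simp add: ennreal_power)
      also have "\<dots> \<le> (ennreal C * (F + I x)) ^ (2 * m)" using elim by (intro power_mono) auto
      also have "\<dots> \<le> ennreal C ^ (2 * m) * (2 ^ (2 * m) * (F ^ (2 * m) + I x ^ (2 * m)))"
        unfolding power_mult_distrib by (intro mult_left_mono ennreal_power_add_le) auto
      also have "\<dots> = ennreal ((4 * C\<^sup>2) ^ m) * (F ^ (2 * m) + I x ^ (2 * m))"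
      proof -
        have "ennreal ((4 * C\<^sup>2) ^ m) = ennreal C ^ (2 * m) * 2 ^ (2 * m)"
        proof -
          have "4 * C\<^sup>2 = (C * 2)\<^sup>2" by (simp add: power2_eq_square)
          then have "(4 * C\<^sup>2) ^ m = (C * 2) ^ (2 * m)" by (simp only: power_mult)
          then have "ennreal ((4 * C\<^sup>2) ^ m) = ennreal (C * 2) ^ (2 * m)"
            using C by (simp only: ennreal_power mult_nonneg_nonneg zero_le_numeral)
          also have "ennreal (C * 2) = ennreal C * 2" using C by (simp add: ennreal_mult)
          finally show ?thesis by (simp only: power_mult_distrib)
        qed
        then show ?thesis by (simp only: mult.assoc)
      qed
      finally show ?case .
    qed
    then have "(\<integral>\<^sup>+ x. ennreal (\<bar>f x\<bar> ^ (2 * m)) \<partial>?M)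
        \<le> (\<integral>\<^sup>+ x. ennreal ((4 * C\<^sup>2) ^ m) * (F ^ (2 * m) + I x ^ (2 * m)) \<partial>?M)"
      by (rule nn_integral_mono_AE)
    also have "\<dots> = ennreal ((4 * C\<^sup>2) ^ m) * (F ^ (2 * m) * ennreal \<mu> + (\<integral>\<^sup>+ x. I x ^ (2 * m) \<partial>?M))"
      by (subst nn_integral_cmult, measurable) (subst nn_integral_add, auto simp: \<mu>)
    also have "\<dots> \<le> ennreal ((4 * C\<^sup>2) ^ m) * (ennreal ((\<mu> * N\<^sup>2) ^ m) * ennreal \<mu> + ennreal (K * (K * real m * (2 * N\<^sup>2)) ^ m))"
    proof (intro mult_left_mono add_mono Ipow m mult_right_mono)
      have "F ^ (2 * m) \<le> ennreal (\<mu> * N\<^sup>2) ^ m" unfolding power_mult using F2 by (rule power_mono) simp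
      then show "F ^ (2 * m) \<le> ennreal ((\<mu> * N\<^sup>2) ^ m)" using \<mu> by (simp add: ennreal_power)
    qed auto
    also have "\<dots> = ennreal ((4 * C\<^sup>2) ^ m * ((\<mu> * N\<^sup>2) ^ m * \<mu> + K * (K * real m * (2 * N\<^sup>2)) ^ m))"
      using \<mu> K by (simp add: ennreal_mult)
    also have "\<dots> \<le> ennreal ((8 * C\<^sup>2 * Q\<^sup>2 * real m * N\<^sup>2) ^ m)"
    proof (rule ennreal_leI)
      have Qm: "r \<le> Q ^ m" if "r \<le> Q" for r
        using that Q(1) m self_le_power[of Q m] by linarith
      let ?X = "(Q * real m * N\<^sup>2) ^ m"
      have "(\<mu> * N\<^sup>2) ^ m \<le> ?X"
      proof (intro power_mono mult_right_mono)
        have "\<mu> * 1 \<le> Q * real m" using Q \<mu> m by (intro mult_mono) auto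
        then show "\<mu> \<le> Q * real m" by simp
      qed (use \<mu> in auto)
      then have 1: "(\<mu> * N\<^sup>2) ^ m * \<mu> \<le> ?X * Q ^ m"
        using Q \<mu> by (intro mult_mono Qm) auto
      have "(K * real m * (2 * N\<^sup>2)) ^ m = ((2 * K) * real m * N\<^sup>2) ^ m" by (simp add: mult_ac)
      also have "\<dots> \<le> ?X" using Q K by (intro power_mono mult_right_mono) auto
      finally have 2: "K * (K * real m * (2 * N\<^sup>2)) ^ m \<le> Q ^ m * ?X"
        using Q K by (intro mult_mono Qm) auto
      have "(\<mu> * N\<^sup>2) ^ m * \<mu> + K * (K * real m * (2 * N\<^sup>2)) ^ m \<le> 2 * (?X * Q ^ m)"
        using 1 2 by (simp add: mult.commute)
      also have "\<dots> \<le> 2 ^ m * (?X * Q ^ m)"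
        using m self_le_power[of "2::real" m] Q by (intro mult_right_mono) auto
      finally have "(4 * C\<^sup>2) ^ m * ((\<mu> * N\<^sup>2) ^ m * \<mu> + K * (K * real m * (2 * N\<^sup>2)) ^ m)
          \<le> (4 * C\<^sup>2) ^ m * (2 ^ m * (?X * Q ^ m))" by (rule mult_left_mono) simp
      also have "\<dots> = (8 * C\<^sup>2 * Q\<^sup>2 * real m * N\<^sup>2) ^ m"
      proof -
        have "(4 * C\<^sup>2) * (2 * ((Q * real m * N\<^sup>2) * Q)) = 8 * C\<^sup>2 * Q\<^sup>2 * real m * N\<^sup>2"
          by (simp add: power2_eq_square)
        then show ?thesis by (simp only: power_mult_distrib[symmetric])
      qed
      finally show "(4 * C\<^sup>2) ^ m * ((\<mu> * N\<^sup>2) ^ m * \<mu> + K * (K * real m * (2 * N\<^sup>2)) ^ m)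
         \<le> (8 * C\<^sup>2 * Q\<^sup>2 * real m * N\<^sup>2) ^ m" .
    qed
    finally show "(\<integral>\<^sup>+ x. ennreal (\<bar>f x\<bar> ^ (2 * m)) \<partial>?M) \<le> ennreal ((8 * C\<^sup>2 * Q\<^sup>2 * real m * (H1_norm \<Omega> f)\<^sup>2) ^ m)"
      unfolding N_def .
  qed
qed

section \<open>The product estimate\<close>

lemma abs_power_eq_powr: "n > 0 \<Longrightarrow> \<bar>x::real\<bar> ^ n = \<bar>x\<bar> powr real n"
  by (cases "x = 0") (auto simp: powr_realpow)

text \<open>
  In the main theorem the norm inequality says that the argument of the logarithm is at least $e$.
\<close>

lemma Lp_imp_L2:
  assumes \<Omega>: "\<Omega> \<in> lmeasurable" and p: "p > 2" and g: "g \<in> Lp_space p \<Omega>"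
  shows "g \<in> Lp_space 2 \<Omega>"
    "Lp_norm 2 \<Omega> g \<le> measure lebesgue \<Omega> powr ((p - 2) / (2 * p)) * Lp_norm p \<Omega> g"
proof -
  let ?M = "lebesgue_on \<Omega>"
  define \<mu> where "\<mu> = measure lebesgue \<Omega>"
  define \<kappa> where "\<kappa> = (p - 2) / (2 * p)"
  let ?n = "Lp_norm p \<Omega> g"
  have \<kappa>: "2 / p + 2 * \<kappa> = 1" "\<kappa> \<ge> 0" using p by (auto simp: \<kappa>_def field_simps)
  have \<mu>: "\<mu> \<ge> 0" "emeasure ?M \<Omega> = ennreal \<mu>"
    using \<Omega> by (simp_all add: \<mu>_def emeasure_restrict_space fmeasurableD emeasure_eq_measure2)
  have [measurable]: "g \<in> borel_measurable ?M" using g by (simp add: Lp_space_def)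
  define a where "a = (\<lambda>i::nat. \<lambda>x. if i = 0 then \<bar>g x\<bar> powr p else 1)"
  define A where "A = (\<lambda>i::nat. if i = 0 then ?n powr p else \<mu>)"
  define \<alpha> where "\<alpha> = (\<lambda>i::nat. if i = 0 then 2 / p else 2 * \<kappa>)"
  have "(\<integral>\<^sup>+ x. ennreal (\<Prod>i\<in>{0,1}. a i x powr \<alpha> i) \<partial>?M) \<le> ennreal (\<Prod>i\<in>{0,1}. A i powr \<alpha> i)"
  proof (rule nn_integral_Hoelder)
    show "\<alpha> i \<ge> 0" for i using p \<kappa> by (auto simp: \<alpha>_def)
    show "sum \<alpha> {0, 1} = 1" using \<kappa> by (simp add: \<alpha>_def)
    show "a i \<in> borel_measurable ?M" for i unfolding a_def by measurable
    show "a i x \<ge> 0" for i x by (simp add: a_def)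
    show "A i \<ge> 0" for i using \<mu> by (simp add: A_def)
    show "(\<integral>\<^sup>+ x. ennreal (a i x) \<partial>?M) \<le> ennreal (A i)" for i
      using nn_integral_Lp_norm[OF g] p \<mu> by (cases "i = 0") (auto simp: a_def A_def)
  qed auto
  also have "(\<lambda>x. \<Prod>i\<in>{0,1}. a i x powr \<alpha> i) = (\<lambda>x. (g x)\<^sup>2)"
    using p by (auto simp: a_def \<alpha>_def powr_powr abs_powr_2)
  also have "(\<Prod>i\<in>{0,1}. A i powr \<alpha> i) = (\<mu> powr \<kappa> * ?n)\<^sup>2"
  proof -
    have "(?n powr p) powr (2 / p) = ?n\<^sup>2"
      using p abs_powr_2[of ?n] Lp_norm_nonneg[of p \<Omega> g] by (simp add: powr_powr)
    moreover have "\<mu> powr (2 * \<kappa>) = (\<mu> powr \<kappa>)\<^sup>2"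
      by (simp add: power2_eq_square flip: powr_add)
    ultimately show ?thesis by (simp add: A_def \<alpha>_def power_mult_distrib)
  qed
  finally have le: "(\<integral>\<^sup>+ x. ennreal ((g x)\<^sup>2) \<partial>?M) \<le> ennreal ((\<mu> powr \<kappa> * ?n)\<^sup>2)" .
  have nn: "0 \<le> \<mu> powr \<kappa> * ?n" by (simp add: Lp_norm_nonneg)
  show "g \<in> Lp_space 2 \<Omega>" "Lp_norm 2 \<Omega> g \<le> measure lebesgue \<Omega> powr ((p - 2) / (2 * p)) * ?n"
    using Lp_norm_2_le[OF _ le nn] by (auto simp: \<mu>_def \<kappa>_def)
qed

text \<open>
  The exponent \<open>\<theta>\<close> is determined by the requirement that the weights $1/m$ of $|f|^{2m}$, $1-\theta$ of
  $g^2$ and $2\theta/p$ of $|g|^p$ add up to 1.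
\<close>

lemma product_L2_bound:
  assumes \<Omega>: "\<Omega> \<in> lmeasurable" and p: "p > 2" and m: "m \<ge> (1::nat)"
    and fm [measurable]: "f \<in> borel_measurable (lebesgue_on \<Omega>)" and A: "0 \<le> A"
    and f: "(\<integral>\<^sup>+ x. ennreal (\<bar>f x\<bar> ^ (2 * m)) \<partial>lebesgue_on \<Omega>) \<le> ennreal (A ^ m)"
    and g: "g \<in> Lp_space p \<Omega>" and pos: "Lp_norm 2 \<Omega> g > 0" "Lp_norm p \<Omega> g > 0"
    and \<theta>: "\<theta> = p / (real m * (p - 2))" "\<theta> \<le> 1"
  shows "(\<integral>\<^sup>+ x. ennreal ((f x * g x)\<^sup>2) \<partial>lebesgue_on \<Omega>)
    \<le> ennreal (A * (Lp_norm 2 \<Omega> g)\<^sup>2 * (Lp_norm p \<Omega> g / Lp_norm 2 \<Omega> g) powr (2 * \<theta>))"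
proof -
  let ?M = "lebesgue_on \<Omega>"
  let ?n2 = "Lp_norm 2 \<Omega> g" and ?np = "Lp_norm p \<Omega> g"
  have gm [measurable]: "g \<in> borel_measurable ?M" using g by (simp add: Lp_space_def)
  have w: "1 / real m + ((1 - \<theta>) + 2 * \<theta> / p) = 1"
  proof -
    have "\<theta> - 2 * \<theta> / p = \<theta> * (p - 2) / p" using p by (simp add: field_simps)
    also have "\<theta> * (p - 2) = p / real m" using p unfolding \<theta>(1) by simp
    finally show ?thesis using p by simp
  qed
  have \<theta>0: "0 < \<theta>" using p m unfolding \<theta>(1) by simp
  define a where "a = (\<lambda>i::nat. \<lambda>x. if i = 0 then \<bar>f x\<bar> ^ (2 * m) else if i = 1 then (g x)\<^sup>2 else \<bar>g x\<bar> powr p)"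
  define B where "B = (\<lambda>i::nat. if i = 0 then A ^ m else if i = 1 then ?n2\<^sup>2 else ?np powr p)"
  define \<alpha> where "\<alpha> = (\<lambda>i::nat. if i = 0 then 1 / real m else if i = 1 then 1 - \<theta> else 2 * \<theta> / p)"
  have three: "(\<Prod>i\<in>{0,1,2}. u i) = u 0 * (u 1 * u 2)" for u :: "nat \<Rightarrow> real" by simp
  have "(\<integral>\<^sup>+ x. ennreal (\<Prod>i\<in>{0,1,2}. a i x powr \<alpha> i) \<partial>?M) \<le> ennreal (\<Prod>i\<in>{0,1,2}. B i powr \<alpha> i)"
  proof (rule nn_integral_Hoelder)
    show "\<alpha> i \<ge> 0" for i using p \<theta> \<theta>0 by (auto simp: \<alpha>_def)
    show "sum \<alpha> {0, 1, 2} = 1" using w by (simp add: \<alpha>_def)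
    show "a i \<in> borel_measurable ?M" for i unfolding a_def by measurable
    show "a i x \<ge> 0" for i x by (simp add: a_def)
    show "B i \<ge> 0" for i using A by (simp add: B_def)
    show "(\<integral>\<^sup>+ x. ennreal (a i x) \<partial>?M) \<le> ennreal (B i)" for i
      using nn_integral_Lp_norm[OF g] nn_integral_L2_norm[OF Lp_imp_L2(1)[OF \<Omega> p g]] f p
      by (auto simp: a_def B_def)
  qed auto
  also have "(\<lambda>x. \<Prod>i\<in>{0,1,2}. a i x powr \<alpha> i) = (\<lambda>x. (f x * g x)\<^sup>2)"
  proof
    fix x
    have 0: "a 0 x powr \<alpha> 0 = (f x)\<^sup>2"
      using m by (simp add: a_def \<alpha>_def abs_power_eq_powr powr_powr abs_powr_2 del: power_mult)
    have "a 1 x = \<bar>g x\<bar> powr 2" "\<alpha> 1 = 1 - \<theta>" by (simp_all only: a_def \<alpha>_def abs_powr_2) simp_all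
    then have 1: "a 1 x powr \<alpha> 1 = \<bar>g x\<bar> powr (2 * (1 - \<theta>))" by (simp only: powr_powr)
    have 2: "a 2 x powr \<alpha> 2 = \<bar>g x\<bar> powr (2 * \<theta>)"
      using p by (simp add: a_def \<alpha>_def powr_powr)
    have "2 * (1 - \<theta>) + 2 * \<theta> = 2" by simp
    then have "a 1 x powr \<alpha> 1 * a 2 x powr \<alpha> 2 = (g x)\<^sup>2"
      by (simp only: 1 2 powr_add[symmetric] abs_powr_2)
    then show "(\<Prod>i\<in>{0,1,2}. a i x powr \<alpha> i) = (f x * g x)\<^sup>2"
      unfolding three 0 by (simp add: power_mult_distrib)
  qed
  also have "(\<Prod>i\<in>{0,1,2}. B i powr \<alpha> i) = A * ?n2\<^sup>2 * (?np / ?n2) powr (2 * \<theta>)"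
  proof -
    have 0: "B 0 powr \<alpha> 0 = A"
      using m A abs_power_eq_powr[of m A] by (simp add: B_def \<alpha>_def powr_powr)
    have n2: "?n2\<^sup>2 = ?n2 powr 2" using pos abs_powr_2[of ?n2] by simp
    have "B 1 = ?n2 powr 2" "\<alpha> 1 = 1 - \<theta>" by (simp_all only: B_def \<alpha>_def n2) simp_all
    then have "B 1 powr \<alpha> 1 = ?n2 powr (2 - 2 * \<theta>)" by (simp only: powr_powr right_diff_distrib mult_1_right)
    also have "\<dots> = ?n2\<^sup>2 / ?n2 powr (2 * \<theta>)" by (simp only: powr_diff n2)
    finally have 1: "B 1 powr \<alpha> 1 = ?n2\<^sup>2 / ?n2 powr (2 * \<theta>)" .
    have 2: "B 2 powr \<alpha> 2 = ?np powr (2 * \<theta>)" using p by (simp add: B_def \<alpha>_def powr_powr)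
    show ?thesis unfolding three 0 1 2 using pos by (simp add: powr_divide)
  qed
  finally show ?thesis .
qed

theorem lemma2p1:
  fixes \<Omega> :: "(real^2) set"
  assumes "smooth_bounded_domain \<Omega>"
  shows "\<exists>C::real. C > 0 \<and>
    (\<forall>p::real. p > 2 \<longrightarrow> (\<forall>f \<in> H1_space \<Omega>. \<forall>g \<in> Lp_space p \<Omega>.
       (\<lambda>x. f x * g x) \<in> Lp_space 2 \<Omega> \<and>
       Lp_norm 2 \<Omega> (\<lambda>x. f x * g x)
         \<le> C * (p / (p - 2)) powr (1 / 2) * H1_norm \<Omega> f * Lp_norm 2 \<Omega> g *
           (ln (exp 1 * measure lebesgue \<Omega> powr ((p - 2) / (2 * p))
                  * (Lp_norm p \<Omega> g / Lp_norm 2 \<Omega> g))) powr (1 / 2)))"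
proof -
  have lm: "\<Omega> \<in> lmeasurable"
    using assms by (intro bounded_set_imp_lmeasurable) (auto simp: smooth_bounded_domain_def)
  define \<mu> where "\<mu> = measure lebesgue \<Omega>"
  obtain B where B: "B \<ge> 0" and pow: "\<And>m f. m \<ge> 1 \<Longrightarrow> f \<in> H1_space \<Omega> \<Longrightarrow>
    (\<integral>\<^sup>+ x. ennreal (\<bar>f x\<bar> ^ (2 * m)) \<partial>lebesgue_on \<Omega>) \<le> ennreal ((B * real m * (H1_norm \<Omega> f)\<^sup>2) ^ m)"
    by (rule H1_power_integral_bound[OF assms]) blast
  \<comment> \<open>The bound for the power of the ratio of the norms of \<open>g\<close>: \<open>1\<close> comes from \<open>2 * \<theta> * L \<le> 1\<close>, and the other
    summand from the power of the measure of the domain inside the logarithm.\<close>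
  define E where "E = exp (1 + \<bar>ln \<mu>\<bar>)"
  define C where "C = sqrt (3 * B * E) + 1"
  have E: "E > 0" by (simp add: E_def)
  have C: "C > 0" "3 * B * E \<le> C\<^sup>2"
  proof -
    have "0 \<le> sqrt (3 * B * E)" using B E by simp
    then show "C > 0" unfolding C_def by linarith
    have "(sqrt (3 * B * E))\<^sup>2 \<le> C\<^sup>2"
      using \<open>0 \<le> sqrt (3 * B * E)\<close> unfolding C_def by (intro power_mono) auto
    then show "3 * B * E \<le> C\<^sup>2" using B E by simp
  qed
  show ?thesis
  proof (intro exI[of _ C] conjI allI impI ballI)
    show "C > 0" by fact
    fix p :: real and f g
    assume p: "p > 2" and f: "f \<in> H1_space \<Omega>" and g: "g \<in> Lp_space p \<Omega>"
    define N where "N = H1_norm \<Omega> f"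
    define n2 where "n2 = Lp_norm 2 \<Omega> g"
    define np where "np = Lp_norm p \<Omega> g"
    define \<kappa> where "\<kappa> = (p - 2) / (2 * p)"
    define L where "L = ln (exp 1 * \<mu> powr \<kappa> * (np / n2))"
    define D where "D = C * (p / (p - 2)) powr (1 / 2) * N * n2 * L powr (1 / 2)"
    have N0: "N \<ge> 0" by (simp add: N_def H1_norm_def sum_nonneg)
    have n20: "n2 \<ge> 0" by (simp add: n2_def Lp_norm_nonneg)
    have D0: "D \<ge> 0" using C N0 n20 by (simp add: D_def)
    have fm [measurable]: "f \<in> borel_measurable (lebesgue_on \<Omega>)"
      using f by (simp add: H1_space_def Lp_space_def)
    have gm [measurable]: "g \<in> borel_measurable (lebesgue_on \<Omega>)" using g by (simp add: Lp_space_def)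
    have gL2: "g \<in> Lp_space 2 \<Omega>" and n2le: "n2 \<le> \<mu> powr \<kappa> * np"
      using Lp_imp_L2[OF lm p g] by (simp_all add: n2_def np_def \<mu>_def \<kappa>_def)
    have "(\<integral>\<^sup>+ x. ennreal ((f x * g x)\<^sup>2) \<partial>lebesgue_on \<Omega>) \<le> ennreal (D\<^sup>2)"
    proof (cases "n2 = 0")
      case True
      then have "(\<integral>\<^sup>+ x. ennreal ((g x)\<^sup>2) \<partial>lebesgue_on \<Omega>) = 0"
        using nn_integral_L2_norm[OF gL2] by (simp add: n2_def)
      then have "AE x in lebesgue_on \<Omega>. g x = 0"
        by (simp add: nn_integral_0_iff_AE)
      then have "AE x in lebesgue_on \<Omega>. ennreal ((f x * g x)\<^sup>2) = 0"
        by eventually_elim simp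
      then have "(\<integral>\<^sup>+ x. ennreal ((f x * g x)\<^sup>2) \<partial>lebesgue_on \<Omega>) = 0"
        by (subst nn_integral_cong_AE) auto
      then show ?thesis by simp
    next
      case False
      then have n2: "n2 > 0" using n20 by simp
      then have "\<mu> powr \<kappa> * np > 0" using n2le by linarith
      then have \<mu>: "\<mu> > 0" and np: "np > 0"
        using Lp_norm_nonneg[of p \<Omega> g]
        by (auto simp: zero_less_mult_iff \<mu>_def np_def measure_nonneg less_le)
      have Leq: "L = 1 + \<kappa> * ln \<mu> + ln (np / n2)"
      proof -
        have q: "np / n2 > 0" "\<mu> powr \<kappa> > 0" using \<mu> np n2 by auto
        have "L = ln (exp 1 * \<mu> powr \<kappa>) + ln (np / n2)"
          unfolding L_def using q by (intro ln_mult_pos) auto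
        also have "ln (exp 1 * \<mu> powr \<kappa>) = 1 + \<kappa> * ln \<mu>"
          using q ln_mult_pos[of "exp 1" "\<mu> powr \<kappa>"] by simp
        finally show ?thesis .
      qed
      have L1: "L \<ge> 1"
      proof -
        have "1 \<le> \<mu> powr \<kappa> * (np / n2)" using n2le n2 by (simp add: field_simps)
        then have "0 \<le> ln (\<mu> powr \<kappa> * (np / n2))" by (rule ln_ge_zero)
        also have "ln (\<mu> powr \<kappa> * (np / n2)) = \<kappa> * ln \<mu> + ln (np / n2)"
          using \<mu> np n2 ln_mult_pos[of "\<mu> powr \<kappa>" "np / n2"] by simp
        finally show ?thesis by (simp add: Leq)
      qed
      define r where "r = p / (p - 2)"
      have r: "r \<ge> 1" using p by (simp add: r_def)
      have rL: "r * L \<ge> 1" using mult_mono[OF r L1] r by simp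
      \<comment> \<open>The factor 2 gives \<open>2 * \<theta> * L \<le> 1\<close>, hence \<open>\<theta> \<le> 1 / 2\<close>, so that all Hoelder weights are positive.\<close>
      define m where "m = nat \<lceil>2 * r * L\<rceil>"
      have m_ge: "2 * (r * L) \<le> real m" unfolding m_def by (simp add: mult.assoc) linarith
      have m_le: "real m \<le> 3 * (r * L)"
      proof -
        have "real m \<le> 2 * (r * L) + 1" unfolding m_def using rL by (simp add: mult.assoc)
        then show ?thesis using rL by linarith
      qed
      have m1: "m \<ge> 1" using m_ge rL by linarith
      define \<theta> where "\<theta> = p / (real m * (p - 2))"
      have \<theta>m: "\<theta> * real m = r" using m1 by (simp add: \<theta>_def r_def)
      have \<theta>0: "\<theta> > 0" using p m1 by (simp add: \<theta>_def)
      have \<theta>L: "2 * \<theta> * L \<le> 1"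
      proof -
        have "\<theta> * (2 * (r * L)) \<le> \<theta> * real m" using m_ge \<theta>0 by (intro mult_left_mono) auto
        then have "r * (2 * \<theta> * L) \<le> r * 1" using \<theta>m by (simp add: mult_ac)
        then show ?thesis using r by simp
      qed
      have \<theta>1: "\<theta> \<le> 1"
        using mult_left_mono[OF L1, of "2 * \<theta>"] \<theta>L \<theta>0 by linarith
      have \<kappa>\<theta>: "2 * \<theta> * \<kappa> = 1 / real m" using p m1 by (simp add: \<theta>_def \<kappa>_def)
      have ratio: "(np / n2) powr (2 * \<theta>) \<le> E"
      proof -
        have "2 * \<theta> * ln (np / n2) = 2 * \<theta> * L - 2 * \<theta> - (2 * \<theta> * \<kappa>) * ln \<mu>"
          unfolding Leq by (simp add: algebra_simps)
        also have "\<dots> \<le> 1 + \<bar>ln \<mu>\<bar>"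
        proof -
          have "- ((2 * \<theta> * \<kappa>) * ln \<mu>) \<le> \<bar>(1 / real m) * ln \<mu>\<bar>" unfolding \<kappa>\<theta> by linarith
          also have "\<dots> \<le> 1 * \<bar>ln \<mu>\<bar>" unfolding abs_mult using m1 by (intro mult_right_mono) auto
          finally show ?thesis using \<theta>L \<theta>0 by linarith
        qed
        finally show ?thesis using np n2 by (simp add: powr_def E_def)
      qed
      have "(\<integral>\<^sup>+ x. ennreal ((f x * g x)\<^sup>2) \<partial>lebesgue_on \<Omega>)
          \<le> ennreal (B * real m * N\<^sup>2 * n2\<^sup>2 * (np / n2) powr (2 * \<theta>))"
        unfolding n2_def np_def
        by (rule product_L2_bound[OF lm p m1 fm _ _ g _ _ \<theta>_def \<theta>1])
           (use B pow[OF m1 f] n2 np in \<open>auto simp: N_def n2_def np_def\<close>)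
      also have "\<dots> \<le> ennreal (D\<^sup>2)"
      proof (rule ennreal_leI)
        have "B * real m * N\<^sup>2 * n2\<^sup>2 * (np / n2) powr (2 * \<theta>)
            \<le> B * (3 * (r * L)) * N\<^sup>2 * n2\<^sup>2 * E"
          using B m_le ratio r L1 by (intro mult_mono mult_nonneg_nonneg) auto
        also have "\<dots> = (3 * B * E) * (r * L * N\<^sup>2 * n2\<^sup>2)" by simp
        also have "\<dots> \<le> C\<^sup>2 * (r * L * N\<^sup>2 * n2\<^sup>2)"
          using C r L1 by (intro mult_right_mono) auto
        also have "\<dots> = D\<^sup>2"
        proof -
          have "(r powr (1 / 2))\<^sup>2 = r" "(L powr (1 / 2))\<^sup>2 = L"
            using r L1 by (simp_all add: powr_half_sqrt)
          then show ?thesis unfolding D_def r_def[symmetric] by (simp add: power_mult_distrib)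
        qed
        finally show "B * real m * N\<^sup>2 * n2\<^sup>2 * (np / n2) powr (2 * \<theta>) \<le> D\<^sup>2" .
      qed
      finally show ?thesis .
    qed
    from Lp_norm_2_le[OF _ this D0]
    have res: "(\<lambda>x. f x * g x) \<in> Lp_space 2 \<Omega>" "Lp_norm 2 \<Omega> (\<lambda>x. f x * g x) \<le> D"
      by auto
    show "(\<lambda>x. f x * g x) \<in> Lp_space 2 \<Omega>" by fact
    show "Lp_norm 2 \<Omega> (\<lambda>x. f x * g x)
         \<le> C * (p / (p - 2)) powr (1 / 2) * H1_norm \<Omega> f * Lp_norm 2 \<Omega> g *
           (ln (exp 1 * measure lebesgue \<Omega> powr ((p - 2) / (2 * p))
                  * (Lp_norm p \<Omega> g / Lp_norm 2 \<Omega> g))) powr (1 / 2)"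
      using res(2) unfolding D_def L_def N_def n2_def np_def \<mu>_def \<kappa>_def .
  qed
qed

end
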